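(* Fix integers $2\le k\le n$. For any $\ell,\ell'\in\{0,\dots,n\}$, the block diagonal matching field polytopes $P_{\mathcal{B}_\ell}$ and $P_{\mathcal{B}_{\ell'}}$ for ${\rm Gr}(k,n)$ can be obtained from one another by a sequence of combinatorial mutations such that all intermediate polytopes are matching field polytopes.
   Context: Let $\mathbf{I}_{k,n}$ be the set of $k$-subsets of $[n]$. A matching field $\Lambda$ is a choice of permutation $\Lambda(I)\in S_k$ for each $I=\{i_1<\dots<i_k\}\in\mathbf{I}_{k,n}$; with $\sigma=\Lambda(I)$ its associated monomial is $x_{\sigma(1)i_1}\cdots x_{\sigma(k)i_k}$ in the entries of a $k\times n$ matrix of variables. Its matching field polytope $P_\Lambda\subset\mathbb{R}^{k\times n}$ is the convex hull of the exponent vectors $\sum_{r=1}^k e_{\sigma(r),i_r}$ of these monomials, $e_{i,j}$ being the standard basis matrices. For $0\le\ell\le n$ the block diagonal matching field $\mathcal{B}_\ell$ is defined by $\mathcal{B}_\ell(I)=\mathrm{id}$ if $|I\cap\{1,\dots,\ell\}|\neq 1$ and $\mathcal{B}_\ell(I)=(12)$ (transposition of $1,2$) otherwise. Combinatorial mutation: let $N\cong\mathbb{Z}^d$, $M=\mathrm{Hom}(N,\mathbb{Z})$, $w\in M$ primitive, $F\subset w^\perp\subset N_\mathbb{R}$ a lattice polytope; the tropical map is $\varphi_{w,F}(u)=u-u_{\min}w$ with $u_{\min}=\min_{f\in F}\langle f,u\rangle$. If $P\subset M_\mathbb{R}$ is a lattice polytope containing the origin and $\varphi_{w,F}(P)$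 is convex, it is a combinatorial mutation of $P$. A sequence of combinatorial mutations is a finite chain of polytopes in which consecutive polytopes are related, after identification via lattice-preserving affine isomorphisms (unimodular equivalences) of the lattices they span, either by a unimodular equivalence or by a combinatorial mutation. *)

theory Defs
  imports "HOL-Analysis.Analysis" "HOL-Combinatorics.Permutations"
begin

text \<open>Points of a finite-dimensional real space are represented as functions
  'i => real (supported on a finite index set).  For R^{k x n} the index type is
  nat x nat (entry (a,b), 1 <= a <= k, 1 <= b <= n); for R^d = M_R it is nat with
  support {..<d}.\<close>

definition conv_hull :: "('i \<Rightarrow> real) set \<Rightarrow> ('i \<Rightarrow> real) set" where
  "conv_hull S = {y. \<exists>T c. finite T \<and> T \<subseteq> S \<and> T \<noteq> {} \<and> (\<forall>x\<in>T. 0 \<le> c x) \<and>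
      sum c T = 1 \<and> y = (\<lambda>i. \<Sum>x\<in>T. c x * x i)}"

definition aff_hull :: "('i \<Rightarrow> real) set \<Rightarrow> ('i \<Rightarrow> real) set" where
  "aff_hull S = {y. \<exists>T c. finite T \<and> T \<subseteq> S \<and> T \<noteq> {} \<and>
      sum c T = 1 \<and> y = (\<lambda>i. \<Sum>x\<in>T. c x * x i)}"

definition is_convex :: "('i \<Rightarrow> real) set \<Rightarrow> bool" where
  "is_convex S \<longleftrightarrow> (\<forall>x\<in>S. \<forall>y\<in>S. \<forall>t::real. 0 \<le> t \<and> t \<le> 1 \<longrightarrow>
      (\<lambda>i. (1 - t) * x i + t * y i) \<in> S)"

definition aff_lattice :: "('i \<Rightarrow> real) set \<Rightarrow> ('i \<Rightarrow> real) set" where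
  "aff_lattice P = {x \<in> aff_hull P. \<forall>i. x i \<in> \<int>}"

definition Rd :: "nat \<Rightarrow> (nat \<Rightarrow> real) set" where
  "Rd d = {x. \<forall>i\<ge>d. x i = 0}"

definition Zd :: "nat \<Rightarrow> (nat \<Rightarrow> real) set" where
  "Zd d = {x \<in> Rd d. \<forall>i. x i \<in> \<int>}"

definition dotp :: "nat \<Rightarrow> (nat \<Rightarrow> real) \<Rightarrow> (nat \<Rightarrow> real) \<Rightarrow> real" where
  "dotp d f u = (\<Sum>i<d. f i * u i)"

definition affine_on :: "('i \<Rightarrow> real) set \<Rightarrow> (('i \<Rightarrow> real) \<Rightarrow> ('j \<Rightarrow> real)) \<Rightarrow> bool" where
  "affine_on A f \<longleftrightarrow> (\<forall>T c. finite T \<and> T \<subseteq> A \<and> T \<noteq> {} \<and> sum c T = 1 \<longrightarrow>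
      f (\<lambda>i. \<Sum>x\<in>T. c x * x i) = (\<lambda>j. \<Sum>x\<in>T. c x * f x j))"

definition lattice_iso :: "('i \<Rightarrow> real) set \<Rightarrow> nat \<Rightarrow> (('i \<Rightarrow> real) \<Rightarrow> (nat \<Rightarrow> real)) \<Rightarrow> bool" where
  "lattice_iso P d f \<longleftrightarrow> affine_on (aff_hull P) f \<and> bij_betw f (aff_hull P) (Rd d)
      \<and> f ` aff_lattice P = Zd d"

definition lattice_polytope :: "nat \<Rightarrow> (nat \<Rightarrow> real) set \<Rightarrow> bool" where
  "lattice_polytope d P \<longleftrightarrow> (\<exists>V. finite V \<and> V \<noteq> {} \<and> V \<subseteq> Zd d \<and> P = conv_hull V)"

definition primitive :: "nat \<Rightarrow> (nat \<Rightarrow> real) \<Rightarrow> bool" where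
  "primitive d w \<longleftrightarrow> w \<in> Zd d \<and> w \<noteq> (\<lambda>_. 0) \<and>
      (\<forall>v\<in>Zd d. \<forall>m::int. w = (\<lambda>i. of_int m * v i) \<longrightarrow> m = 1 \<or> m = -1)"

definition trop_map :: "nat \<Rightarrow> (nat \<Rightarrow> real) \<Rightarrow> (nat \<Rightarrow> real) set \<Rightarrow> (nat \<Rightarrow> real) \<Rightarrow> (nat \<Rightarrow> real)" where
  "trop_map d w F u = (\<lambda>i. u i - (INF f\<in>F. dotp d f u) * w i)"

definition comb_mutation :: "nat \<Rightarrow> (nat \<Rightarrow> real) set \<Rightarrow> (nat \<Rightarrow> real) set \<Rightarrow> bool" where
  "comb_mutation d P Q \<longleftrightarrow> lattice_polytope d P \<and> (\<lambda>_. 0) \<in> P \<and>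
     (\<exists>w F. primitive d w \<and> lattice_polytope d F \<and> (\<forall>f\<in>F. dotp d f w = 0) \<and>
        is_convex (trop_map d w F ` P) \<and> Q = trop_map d w F ` P)"

text \<open>One step of a sequence of combinatorial mutations: after identifying the
  lattices spanned by P and Q with Z^d via lattice-preserving affine isomorphisms,
  the images coincide (unimodular equivalence) or are related by a mutation.\<close>
definition mutation_step :: "('i \<Rightarrow> real) set \<Rightarrow> ('i \<Rightarrow> real) set \<Rightarrow> bool" where
  "mutation_step P Q \<longleftrightarrow> (\<exists>d f g. lattice_iso P d f \<and> lattice_iso Q d g \<and>
      (f ` P = g ` Q \<or> comb_mutation d (f ` P) (g ` Q)))"

definition k_subsets :: "nat \<Rightarrow> nat \<Rightarrow> nat set set" where
  "k_subsets k n = {I. I \<subseteq> {1..n} \<and> card I = k}"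

definition matching_field :: "nat \<Rightarrow> nat \<Rightarrow> (nat set \<Rightarrow> nat \<Rightarrow> nat) \<Rightarrow> bool" where
  "matching_field k n \<Lambda> \<longleftrightarrow> (\<forall>I\<in>k_subsets k n. \<Lambda> I permutes {1..k})"

text \<open>Exponent vector sum_{r=1}^k e_{sigma(r), i_r}, sigma = Lambda(I), i_1 < ... < i_k.\<close>
definition mf_vertex :: "nat \<Rightarrow> (nat set \<Rightarrow> nat \<Rightarrow> nat) \<Rightarrow> nat set \<Rightarrow> (nat \<times> nat \<Rightarrow> real)" where
  "mf_vertex k \<Lambda> I = (\<lambda>(a, b). if \<exists>r\<in>{1..k}. a = \<Lambda> I r \<and> b = sorted_list_of_set I ! (r - 1)
      then 1 else 0)"

definition mf_polytope :: "nat \<Rightarrow> nat \<Rightarrow> (nat set \<Rightarrow> nat \<Rightarrow> nat) \<Rightarrow> (nat \<times> nat \<Rightarrow> real) set" where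
  "mf_polytope k n \<Lambda> = conv_hull (mf_vertex k \<Lambda> ` k_subsets k n)"

definition block_diag :: "nat \<Rightarrow> nat set \<Rightarrow> nat \<Rightarrow> nat" where
  "block_diag l I = (if card (I \<inter> {1..l}) \<noteq> 1 then id else Transposition.transpose 1 2)"

end

theory Submission
  imports Defs
begin

text \<open>The block diagonal matching field \<open>B_l\<close> puts into row 1 whichever of the two smallest elements of
  \<open>I\<close> comes first in the cyclic order \<open>l+1, \<dots>, n, 1, \<dots>, l\<close> of the columns. Going from \<open>B_l\<close> to
  \<open>B_(l+1)\<close> moves the column \<open>p = l+1\<close> from the first to the last place of this order, which is done
  by transpositions of adjacent columns \<open>p, j\<close>. Such a transposition changes only the vertices with
  \<open>p\<close> in row 1 and \<open>j\<close> in row 2: they are exactly the ones on which the linear form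
  \<open>f u = (\<Sum>a before p. u(1,a)) - (\<Sum>b up to j. u(2,b))\<close> is \<open>-1\<close>, and they are translated by
  \<open>w = e(1,j) + e(2,p) - e(1,p) - e(2,j)\<close>, where \<open>f w = 0\<close>. So the new vertices are the images of
  the old ones under the piecewise linear map \<open>u - min 0 (f u) w\<close>. This map also carries the polytope
  onto the new one, because a vertex with \<open>f = -1\<close> and one with \<open>f = 1\<close> can be exchanged, before and
  after the mutation, for two vertices with \<open>f = 0\<close> and the same sum. If \<open>f\<close> takes both signs, these
  exchanges put \<open>w\<close> into the direction space of the polytope and the step is a mutation; otherwise it
  is a unimodular equivalence. As \<open>B_0 = B_n\<close>, increasing \<open>l\<close> cyclically reaches every block diagonal
  matching field from every other.\<close>

section \<open>Finite convex and affine combinations\<close>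

text \<open>Several indices may give the same point, so one index is chosen for each point of
  \<open>T\<close> and carries its whole weight; all others get 0. Stating the sum for every
  \<open>g\<close> yields the total weight (\<open>g = 1\<close>) and all coordinates at
  once.\<close>

lemma weights_pull_back:
  fixes v :: "'k \<Rightarrow> 'i \<Rightarrow> real" and c :: "('i \<Rightarrow> real) \<Rightarrow> real"
  assumes "finite K" "T \<subseteq> v ` K"
  obtains c' where "\<And>k. c' k = 0 \<or> v k \<in> T \<and> c' k = c (v k)"
    "\<And>g :: ('i \<Rightarrow> real) \<Rightarrow> real. (\<Sum>x\<in>T. c x * g x) = (\<Sum>k\<in>K. c' k * g (v k))"
proof -
  obtain K' where K': "K' \<subseteq> K" "inj_on v K'" "T = v ` K'"
    using assms(2) by (meson subset_image_inj)
  define c' where "c' = (\<lambda>k. if k \<in> K' then c (v k) else 0)"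
  have "(\<Sum>x\<in>T. c x * g x) = (\<Sum>k\<in>K. c' k * g (v k))" for g :: "('i \<Rightarrow> real) \<Rightarrow> real"
  proof -
    have "(\<Sum>x\<in>T. c x * g x) = (\<Sum>k\<in>K'. c' k * g (v k))"
      using K' by (simp add: sum.reindex c'_def)
    also have "\<dots> = (\<Sum>k\<in>K. c' k * g (v k))"
      using K'(1) assms(1) by (intro sum.mono_neutral_left) (auto simp: c'_def)
    finally show ?thesis .
  qed
  moreover have "c' k = 0 \<or> v k \<in> T \<and> c' k = c (v k)" for k
    using K'(3) by (auto simp: c'_def)
  ultimately show ?thesis using that by blast
qed

lemma weights_push_forward:
  fixes v :: "'k \<Rightarrow> 'i \<Rightarrow> real" and g :: "('i \<Rightarrow> real) \<Rightarrow> real"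
  assumes "finite K"
  shows "(\<Sum>k\<in>K. c k * g (v k)) = (\<Sum>x\<in>v ` K. sum c {k\<in>K. v k = x} * g x)"
proof -
  have "(\<Sum>k\<in>K. c k * g (v k)) = (\<Sum>x\<in>v ` K. \<Sum>k\<in>{k\<in>K. v k = x}. c k * g (v k))"
    by (rule sum.image_gen[OF assms])
  also have "\<dots> = (\<Sum>x\<in>v ` K. sum c {k\<in>K. v k = x} * g x)"
    by (intro sum.cong refl) (simp add: sum_distrib_right)
  finally show ?thesis .
qed

text \<open>A fixed finite index family in place of a varying subset \<open>T\<close> lets
  combinations be added and altered coefficientwise, even if points coincide. One direction chooses
  an index for each point, the other adds up the weights of all indices of a point.\<close>

lemma conv_hull_image:
  fixes v :: "'k \<Rightarrow> 'i \<Rightarrow> real"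
  assumes "finite K"
  shows "conv_hull (v ` K) =
    {y. \<exists>c. (\<forall>k\<in>K. 0 \<le> c k) \<and> sum c K = 1 \<and> y = (\<lambda>i. \<Sum>k\<in>K. c k * v k i)}"
proof (intro set_eqI iffI)
  fix y assume "y \<in> conv_hull (v ` K)"
  then obtain T c where T: "finite T" "T \<subseteq> v ` K" "\<forall>x\<in>T. 0 \<le> c x" "sum c T = 1"
    "y = (\<lambda>i. \<Sum>x\<in>T. c x * x i)" unfolding conv_hull_def by blast
  obtain c' where c': "\<And>k. c' k = 0 \<or> v k \<in> T \<and> c' k = c (v k)"
    "\<And>g :: ('i \<Rightarrow> real) \<Rightarrow> real. (\<Sum>x\<in>T. c x * g x) = (\<Sum>k\<in>K. c' k * g (v k))"
    using weights_pull_back[OF assms T(2), of c] by blast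
  have "0 \<le> c' k" for k using c'(1)[of k] T(3) by auto
  moreover have "sum c' K = 1" using c'(2)[of "\<lambda>_. 1"] T(4) by simp
  moreover have "y = (\<lambda>i. \<Sum>k\<in>K. c' k * v k i)"
    unfolding T(5) using c'(2)[of "\<lambda>x. x i" for i] by (intro ext) simp
  ultimately show "y \<in> {y. \<exists>c. (\<forall>k\<in>K. 0 \<le> c k) \<and> sum c K = 1 \<and> y = (\<lambda>i. \<Sum>k\<in>K. c k * v k i)}"
    by (intro CollectI exI[of _ c'] conjI ballI)
next
  fix y assume "y \<in> {y. \<exists>c. (\<forall>k\<in>K. 0 \<le> c k) \<and> sum c K = 1 \<and> y = (\<lambda>i. \<Sum>k\<in>K. c k * v k i)}"
  then obtain c where c: "\<forall>k\<in>K. 0 \<le> c k" "sum c K = 1" "y = (\<lambda>i. \<Sum>k\<in>K. c k * v k i)"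
    by blast
  let ?c = "\<lambda>x. sum c {k\<in>K. v k = x}"
  have "K \<noteq> {}" using c(2) by auto
  moreover have "sum ?c (v ` K) = 1"
    using weights_push_forward[OF assms, of c "\<lambda>_. 1" v] c(2) by simp
  moreover have "y = (\<lambda>i. \<Sum>x\<in>v ` K. ?c x * x i)"
    unfolding c(3) by (intro ext weights_push_forward[OF assms])
  moreover have "\<forall>x\<in>v ` K. 0 \<le> ?c x" using c(1) by (auto intro: sum_nonneg)
  ultimately show "y \<in> conv_hull (v ` K)"
    unfolding conv_hull_def using assms
    by (intro CollectI exI[of _ "v ` K"] exI[of _ ?c]) simp
qed

lemma aff_hull_image:
  fixes v :: "'k \<Rightarrow> 'i \<Rightarrow> real"
  assumes "finite K"
  shows "aff_hull (v ` K) =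
    {y. \<exists>c. sum c K = 1 \<and> y = (\<lambda>i. \<Sum>k\<in>K. c k * v k i)}"
proof (intro set_eqI iffI)
  fix y assume "y \<in> aff_hull (v ` K)"
  then obtain T c where T: "finite T" "T \<subseteq> v ` K" "sum c T = 1"
    "y = (\<lambda>i. \<Sum>x\<in>T. c x * x i)" unfolding aff_hull_def by blast
  obtain c' where "\<And>k. c' k = 0 \<or> v k \<in> T \<and> c' k = c (v k)" and c':
    "\<And>g :: ('i \<Rightarrow> real) \<Rightarrow> real. (\<Sum>x\<in>T. c x * g x) = (\<Sum>k\<in>K. c' k * g (v k))"
    using weights_pull_back[OF assms T(2), of c] by blast
  have "sum c' K = 1" using c'[of "\<lambda>_. 1"] T(3) by simp
  moreover have "y = (\<lambda>i. \<Sum>k\<in>K. c' k * v k i)"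
    unfolding T(4) using c'[of "\<lambda>x. x i" for i] by (intro ext) simp
  ultimately show "y \<in> {y. \<exists>c. sum c K = 1 \<and> y = (\<lambda>i. \<Sum>k\<in>K. c k * v k i)}"
    by (intro CollectI exI[of _ c'] conjI ballI)
next
  fix y assume "y \<in> {y. \<exists>c. sum c K = 1 \<and> y = (\<lambda>i. \<Sum>k\<in>K. c k * v k i)}"
  then obtain c where c: "sum c K = 1" "y = (\<lambda>i. \<Sum>k\<in>K. c k * v k i)"
    by blast
  let ?c = "\<lambda>x. sum c {k\<in>K. v k = x}"
  have "K \<noteq> {}" using c(1) by auto
  moreover have "sum ?c (v ` K) = 1"
    using weights_push_forward[OF assms, of c "\<lambda>_. 1" v] c(1) by simp
  moreover have "y = (\<lambda>i. \<Sum>x\<in>v ` K. ?c x * x i)"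
    unfolding c(2) by (intro ext weights_push_forward[OF assms])
  ultimately show "y \<in> aff_hull (v ` K)"
    unfolding aff_hull_def using assms
    by (intro CollectI exI[of _ "v ` K"] exI[of _ ?c]) simp
qed

lemmas conv_hull_finite = conv_hull_image[where v = "\<lambda>x. x", simplified]
lemmas aff_hull_finite = aff_hull_image[where v = "\<lambda>x. x", simplified]

lemma aff_hull_closed:
  assumes "finite V" "finite K" "\<And>k. k \<in> K \<Longrightarrow> v k \<in> aff_hull V" "sum c K = 1"
  shows "(\<lambda>i. \<Sum>k\<in>K. c k * v k i) \<in> aff_hull V"
proof -
  have "\<forall>k\<in>K. \<exists>e. sum e V = 1 \<and> v k = (\<lambda>i. \<Sum>x\<in>V. e x * x i)"
    using assms(3) by (auto simp: aff_hull_finite[OF assms(1)])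
  then obtain e where e: "\<And>k. k \<in> K \<Longrightarrow> sum (e k) V = 1"
    "\<And>k. k \<in> K \<Longrightarrow> v k = (\<lambda>i. \<Sum>x\<in>V. e k x * x i)"
    by metis
  let ?c = "\<lambda>x. \<Sum>k\<in>K. c k * e k x"
  have "sum ?c V = (\<Sum>k\<in>K. c k * sum (e k) V)"
    by (subst sum.swap) (simp add: sum_distrib_left)
  also have "\<dots> = 1" using e(1) assms(4) by simp
  finally have "sum ?c V = 1" .
  moreover have "(\<Sum>k\<in>K. c k * v k i) = (\<Sum>x\<in>V. ?c x * x i)" for i
  proof -
    have "(\<Sum>k\<in>K. c k * v k i) = (\<Sum>k\<in>K. \<Sum>x\<in>V. c k * e k x * x i)"
      using e(2) by (simp add: sum_distrib_left mult.assoc)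
    also have "\<dots> = (\<Sum>x\<in>V. ?c x * x i)"
      by (subst sum.swap) (simp add: sum_distrib_right)
    finally show ?thesis .
  qed
  ultimately show ?thesis
    unfolding aff_hull_finite[OF assms(1)] by (intro CollectI exI[of _ ?c] conjI ext)
qed

lemma aff_hull_translate:
  assumes "finite V" "x \<in> aff_hull V" "y \<in> aff_hull V" "z \<in> aff_hull V"
  shows "(\<lambda>i. x i + a * (y i - z i)) \<in> aff_hull V"
proof -
  \<comment> \<open>Three indices with weights \<open>1\<close>, \<open>a\<close>,
    \<open>- a\<close>; they stay distinct even if some of \<open>x\<close>, \<open>y\<close>,
    \<open>z\<close> coincide.\<close>
  define v where "v = (\<lambda>m::nat. if m = 0 then x else if m = 1 then y else z)"
  define c where "c = (\<lambda>m::nat. if m = 0 then 1 else if m = 1 then a else - a)"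
  have "(\<lambda>i. \<Sum>m<3. c m * v m i) \<in> aff_hull V"
    by (rule aff_hull_closed[OF assms(1)]) (use assms in \<open>auto simp: v_def c_def eval_nat_numeral\<close>)
  then show ?thesis by (simp add: v_def c_def eval_nat_numeral algebra_simps)
qed

lemma subset_conv_hull: "V \<subseteq> conv_hull V"
proof
  fix x assume "x \<in> V"
  then show "x \<in> conv_hull V"
    unfolding conv_hull_def by (intro CollectI exI[of _ "{x}"] exI[of _ "\<lambda>_. 1"]) auto
qed

lemma conv_hull_subset_aff_hull: "conv_hull V \<subseteq> aff_hull V"
  unfolding conv_hull_def aff_hull_def by blast

lemma aff_hull_subset_iff:
  assumes "finite W" shows "aff_hull V \<subseteq> aff_hull W \<longleftrightarrow> V \<subseteq> aff_hull W"
proof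
  assume "aff_hull V \<subseteq> aff_hull W"
  then show "V \<subseteq> aff_hull W"
    using subset_conv_hull conv_hull_subset_aff_hull by blast
next
  assume V: "V \<subseteq> aff_hull W"
  show "aff_hull V \<subseteq> aff_hull W"
  proof
    fix y assume "y \<in> aff_hull V"
    then obtain T c where T: "finite T" "T \<subseteq> V" "sum c T = 1"
      "y = (\<lambda>i. \<Sum>x\<in>T. c x * x i)" unfolding aff_hull_def by blast
    show "y \<in> aff_hull W"
      unfolding T(4) by (rule aff_hull_closed[OF assms T(1) _ T(3)]) (use T V in auto)
  qed
qed

lemma aff_hull_mono: "V \<subseteq> W \<Longrightarrow> aff_hull V \<subseteq> aff_hull W"
  unfolding aff_hull_def by blast

lemma aff_hull_conv_hull: "finite V \<Longrightarrow> aff_hull (conv_hull V) = aff_hull V"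
  by (simp add: antisym aff_hull_subset_iff conv_hull_subset_aff_hull aff_hull_mono subset_conv_hull)

lemma conv_hull_mono: "V \<subseteq> W \<Longrightarrow> conv_hull V \<subseteq> conv_hull W"
  unfolding conv_hull_def by blast

lemma is_convex_conv_hull:
  assumes "finite V" shows "is_convex (conv_hull V)"
  unfolding is_convex_def
proof (intro ballI allI impI)
  fix x y :: "'a \<Rightarrow> real" and t :: real
  assume "x \<in> conv_hull V" "y \<in> conv_hull V" and t: "0 \<le> t \<and> t \<le> 1"
  then obtain c e where c: "\<forall>v\<in>V. 0 \<le> c v" "sum c V = 1" "x = (\<lambda>i. \<Sum>v\<in>V. c v * v i)"
    and e: "\<forall>v\<in>V. 0 \<le> e v" "sum e V = 1" "y = (\<lambda>i. \<Sum>v\<in>V. e v * v i)"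
    unfolding conv_hull_finite[OF assms] by blast
  let ?c = "\<lambda>v. (1 - t) * c v + t * e v"
  have "\<forall>v\<in>V. 0 \<le> ?c v" using c(1) e(1) t by simp
  moreover have "sum ?c V = 1"
    using c(2) e(2) by (simp add: sum.distrib flip: sum_distrib_left)
  moreover have "(\<lambda>i. (1 - t) * x i + t * y i) = (\<lambda>i. \<Sum>v\<in>V. ?c v * v i)"
    unfolding c(3) e(3) by (simp add: sum.distrib sum_distrib_left ring_distribs mult.assoc)
  ultimately show "(\<lambda>i. (1 - t) * x i + t * y i) \<in> conv_hull V"
    unfolding conv_hull_finite[OF assms] by (intro CollectI exI[of _ ?c] conjI)
qed

lemma affine_on_subset: "affine_on B f \<Longrightarrow> A \<subseteq> B \<Longrightarrow> affine_on A f"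
  unfolding affine_on_def by blast

text \<open>Every point of the hull is one combination of the points of \<open>V\<close>, so
  affinity of \<open>f\<close> on \<open>V\<close> alone controls \<open>f\<close> on the whole
  hull.\<close>

lemma affine_on_image_conv_hull:
  assumes "finite V" "V \<noteq> {}" "affine_on V f"
  shows "f ` conv_hull V = conv_hull (f ` V)"
proof -
  have *: "f (\<lambda>i. \<Sum>x\<in>V. c x * x i) = (\<lambda>j. \<Sum>x\<in>V. c x * f x j)" if "sum c V = 1" for c
    using assms that unfolding affine_on_def by blast
  show ?thesis
  proof (intro equalityI subsetI)
    show "y \<in> conv_hull (f ` V)" if y: "y \<in> f ` conv_hull V" for y
    proof -
      obtain c where c: "\<forall>x\<in>V. 0 \<le> c x" "sum c V = 1" "y = f (\<lambda>i. \<Sum>x\<in>V. c x * x i)"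
        using y unfolding conv_hull_finite[OF assms(1)] by blast
      show ?thesis unfolding c(3) *[OF c(2)] conv_hull_image[OF assms(1)] using c(1,2) by blast
    qed
    show "y \<in> f ` conv_hull V" if y: "y \<in> conv_hull (f ` V)" for y
    proof -
      obtain c where c: "\<forall>x\<in>V. 0 \<le> c x" "sum c V = 1" "y = (\<lambda>j. \<Sum>x\<in>V. c x * f x j)"
        using y unfolding conv_hull_image[OF assms(1)] by blast
      have "(\<lambda>i. \<Sum>x\<in>V. c x * x i) \<in> conv_hull V"
        unfolding conv_hull_finite[OF assms(1)] using c(1,2) by blast
      then show ?thesis unfolding c(3) *[OF c(2), symmetric] by (rule imageI)
    qed
  qed
qed

lemma affine_on_image_aff_hull:
  assumes "finite V" "V \<noteq> {}" "affine_on V f"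
  shows "f ` aff_hull V = aff_hull (f ` V)"
proof -
  have *: "f (\<lambda>i. \<Sum>x\<in>V. c x * x i) = (\<lambda>j. \<Sum>x\<in>V. c x * f x j)" if "sum c V = 1" for c
    using assms that unfolding affine_on_def by blast
  show ?thesis
  proof (intro equalityI subsetI)
    show "y \<in> aff_hull (f ` V)" if y: "y \<in> f ` aff_hull V" for y
    proof -
      obtain c where c: "sum c V = 1" "y = f (\<lambda>i. \<Sum>x\<in>V. c x * x i)"
        using y unfolding aff_hull_finite[OF assms(1)] by blast
      show ?thesis unfolding c(2) *[OF c(1)] aff_hull_image[OF assms(1)] using c(1) by blast
    qed
    show "y \<in> f ` aff_hull V" if y: "y \<in> aff_hull (f ` V)" for y
    proof -
      obtain c where c: "sum c V = 1" "y = (\<lambda>j. \<Sum>x\<in>V. c x * f x j)"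
        using y unfolding aff_hull_image[OF assms(1)] by blast
      have "(\<lambda>i. \<Sum>x\<in>V. c x * x i) \<in> aff_hull V"
        unfolding aff_hull_finite[OF assms(1)] using c(1) by blast
      then show ?thesis unfolding c(2) *[OF c(1), symmetric] by (rule imageI)
    qed
  qed
qed

section \<open>Lattice coordinates on affine hulls\<close>

text \<open>The real linear span, not the lattice generated by \<open>V\<close>: the coefficient
  \<open>a\<close> is an arbitrary real.\<close>

inductive_set lspan :: "('i \<Rightarrow> real) set \<Rightarrow> ('i \<Rightarrow> real) set" for V where
  lspan_zero: "(\<lambda>_. 0) \<in> lspan V"
| lspan_step: "v \<in> V \<Longrightarrow> x \<in> lspan V \<Longrightarrow> (\<lambda>i. a * v i + x i) \<in> lspan V"

lemma lspan_add: "x \<in> lspan V \<Longrightarrow> y \<in> lspan V \<Longrightarrow> (\<lambda>i. x i + y i) \<in> lspan V"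
proof (induction rule: lspan.induct)
  case (lspan_step v x a)
  then have "(\<lambda>i. a * v i + (x i + y i)) \<in> lspan V" by (intro lspan.lspan_step) auto
  then show ?case by (simp add: add.assoc)
qed simp

lemma lspan_scale: "x \<in> lspan V \<Longrightarrow> (\<lambda>i. b * x i) \<in> lspan V"
proof (induction rule: lspan.induct)
  case (lspan_step v x a)
  then have "(\<lambda>i. (b * a) * v i + b * x i) \<in> lspan V" by (intro lspan.lspan_step) auto
  then show ?case by (simp add: algebra_simps)
qed (simp add: lspan_zero)

lemma lspan_base: "v \<in> V \<Longrightarrow> v \<in> lspan V"
  using lspan_step[of v V "\<lambda>_. 0" 1] lspan_zero by auto

lemma lspan_diff: "x \<in> lspan V \<Longrightarrow> y \<in> lspan V \<Longrightarrow> (\<lambda>i. x i - a * y i) \<in> lspan V"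
  using lspan_add[OF _ lspan_scale[of y V "- a"]] by force

lemma lspan_sum:
  "finite K \<Longrightarrow> (\<And>k. k \<in> K \<Longrightarrow> v k \<in> lspan V) \<Longrightarrow> (\<lambda>i. \<Sum>k\<in>K. c k * v k i) \<in> lspan V"
proof (induction K rule: finite_induct)
  case (insert k K)
  then show ?case using lspan_add[OF lspan_scale[of "v k" V "c k"]] by simp
qed (simp add: lspan_zero)

lemma lspan_eq_0: "x \<in> lspan V \<Longrightarrow> (\<And>v. v \<in> V \<Longrightarrow> v i = 0) \<Longrightarrow> x i = 0"
  by (induction rule: lspan.induct) auto

lemma lspan_subset:
  assumes "V \<subseteq> lspan W" shows "lspan V \<subseteq> lspan W"
proof
  fix x assume "x \<in> lspan V"
  then show "x \<in> lspan W"
  proof induction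
    case (lspan_step v x a)
    then show ?case using assms by (intro lspan_add lspan_scale) auto
  qed (rule lspan_zero)
qed

text \<open>Weights with sum 1 make the \<open>p\<close> terms cancel, so questions about the affine
  hull become linear ones about the differences \<open>v - p\<close>.\<close>

lemma aff_hull_eq_lspan:
  assumes "finite V" "p \<in> V"
  shows "y \<in> aff_hull V \<longleftrightarrow> (\<lambda>i. y i - p i) \<in> lspan ((\<lambda>v i. v i - p i) ` V)"
proof
  assume "y \<in> aff_hull V"
  then obtain c where c: "sum c V = 1" "y = (\<lambda>i. \<Sum>v\<in>V. c v * v i)"
    using aff_hull_finite[OF assms(1)] by auto
  have "y i - p i = (\<Sum>v\<in>V. c v * (v i - p i))" for i
    using c by (simp add: sum_subtractf right_diff_distrib flip: sum_distrib_right)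
  moreover have "(\<lambda>i. \<Sum>v\<in>V. c v * (v i - p i)) \<in> lspan ((\<lambda>v i. v i - p i) ` V)"
    using assms(1) by (intro lspan_sum lspan_base) auto
  ultimately show "(\<lambda>i. y i - p i) \<in> lspan ((\<lambda>v i. v i - p i) ` V)" by simp
next
  have V: "V \<subseteq> aff_hull V"
    using subset_conv_hull conv_hull_subset_aff_hull by blast
  have *: "(\<lambda>i. p i + x i) \<in> aff_hull V" if "x \<in> lspan ((\<lambda>v i. v i - p i) ` V)" for x
    using that
  proof induction
    case (lspan_step d x a)
    then obtain v where v: "v \<in> V" "d = (\<lambda>i. v i - p i)" by blast
    have "(\<lambda>i. (p i + x i) + a * (v i - p i)) \<in> aff_hull V"
      using lspan_step.IH v(1) assms V by (intro aff_hull_translate) auto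
    then show ?case by (simp add: v(2) algebra_simps)
  qed (use assms V in auto)
  assume "(\<lambda>i. y i - p i) \<in> lspan ((\<lambda>v i. v i - p i) ` V)"
  from *[OF this] show "y \<in> aff_hull V" by simp
qed

definition integer_point :: "('i \<Rightarrow> real) \<Rightarrow> bool" where
  "integer_point x \<longleftrightarrow> (\<forall>i. x i \<in> \<int>)"

text \<open>The values of coordinate \<open>s\<close> at the integer points of the span form a
  nonzero subgroup of the integers, hence consist of the multiples of its least positive element;
  \<open>z\<close> is a point attaining it.\<close>

lemma integer_point_value_multiple:
  assumes "\<exists>x\<in>lspan V. integer_point x \<and> x s \<noteq> 0"
  shows "\<exists>z\<in>lspan V. integer_point z \<and> z s > 0 \<and>
    (\<forall>x\<in>lspan V. integer_point x \<longrightarrow> x s / z s \<in> \<int>)"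
proof -
  define P where "P = (\<lambda>m::nat. m > 0 \<and> (\<exists>x\<in>lspan V. integer_point x \<and> x s = real m))"
  have "\<exists>m. P m"
  proof -
    obtain x where x: "x \<in> lspan V" "integer_point x" "x s \<noteq> 0" using assms by blast
    then obtain m :: int where m: "x s = of_int m" by (auto simp: integer_point_def elim: Ints_cases)
    have "(\<lambda>i. of_int (sgn m) * x i) \<in> lspan V" by (rule lspan_scale[OF x(1)])
    moreover have "integer_point (\<lambda>i. of_int (sgn m) * x i)" using x(2) by (auto simp: integer_point_def)
    moreover have "of_int (sgn m) * x s = real (nat \<bar>m\<bar>)"
      using m by (simp add: abs_if sgn_if)
    moreover have "nat \<bar>m\<bar> > 0" using x(3) m by simp
    ultimately show ?thesis unfolding P_def by blast
  qed
  define g where "g = (LEAST m. P m)"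
  have g: "P g" unfolding g_def using \<open>\<exists>m. P m\<close> by (rule LeastI_ex)
  then obtain z where z: "z \<in> lspan V" "integer_point z" "z s = real g" "g > 0"
    unfolding P_def by blast
  have "x s / z s \<in> \<int>" if x: "x \<in> lspan V" "integer_point x" for x
  proof -
    obtain m :: int where m: "x s = of_int m" using x by (auto simp: integer_point_def elim: Ints_cases)
    define r where "r = m mod int g"
    have r: "0 \<le> r" "r < int g" using z(4) by (auto simp: r_def)
    \<comment> \<open>Division with remainder: this integer point of the span has the remainder
      \<open>r\<close> as its coordinate \<open>s\<close>, so minimality of \<open>g\<close> forces
      \<open>r = 0\<close>.\<close>
    have "(\<lambda>i. x i - of_int (m div int g) * z i) \<in> lspan V" by (rule lspan_diff[OF x(1) z(1)])
    moreover have "integer_point (\<lambda>i. x i - of_int (m div int g) * z i)"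
      using x(2) z(2) by (auto simp: integer_point_def)
    moreover have "x s - of_int (m div int g) * z s = real (nat r)"
    proof -
      have "m - (m div int g) * int g = r" by (simp add: r_def minus_div_mult_eq_mod)
      then have "real_of_int (m - (m div int g) * int g) = real (nat r)" using r by simp
      then show ?thesis using z(3) m by simp
    qed
    ultimately have "r > 0 \<Longrightarrow> P (nat r)" unfolding P_def by auto
    then have "r = 0" using r not_less_Least[of "nat r" P] unfolding g_def[symmetric] by force
    then have "m = (m div int g) * int g" unfolding r_def by (simp add: mod_0_imp_dvd)
    then have "x s = of_int (m div int g) * z s" using m z(3)
      by (metis of_int_mult of_int_of_nat_eq)
    then show ?thesis using z(3,4) by simp
  qed
  then show ?thesis using z by (intro bexI[of _ z] conjI) auto
qed

text \<open>Induction on the coordinates in \<open>S\<close>. If some generator is nonzero at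
  \<open>s\<close>, an integer point \<open>z\<close> with least positive coordinate
  \<open>s\<close> splits off, and the rest of the span lies in the hyperplane where coordinate
  \<open>s\<close> vanishes. The last conjunct says that \<open>B\<close> is a basis of the lattice
  of all integer points of the span, not merely of a sublattice.\<close>

lemma lattice_basis:
  fixes V :: "('i \<Rightarrow> real) set"
  assumes "finite S" "\<And>v. v \<in> V \<Longrightarrow> integer_point v" "\<And>v i. v \<in> V \<Longrightarrow> i \<notin> S \<Longrightarrow> v i = 0"
  shows "\<exists>d B. (\<forall>m. integer_point (B m)) \<and>
    bij_betw (\<lambda>c i. \<Sum>m<d. c m * B m i) (Rd d) (lspan V) \<and>
    (\<forall>c\<in>Rd d. integer_point (\<lambda>i. \<Sum>m<d. c m * B m i) \<longrightarrow> c \<in> Zd d)"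
  using assms
proof (induction S arbitrary: V rule: finite_induct)
  case empty
  have "lspan V = {\<lambda>_. 0}"
    using lspan_eq_0[of _ V] empty(2) lspan_zero by (auto simp: fun_eq_iff)
  moreover have "Rd 0 = {\<lambda>_. 0}" by (auto simp: Rd_def)
  ultimately show ?case
    by (intro exI[of _ 0] exI[of _ "\<lambda>_ _. 0"]) (auto simp: integer_point_def Zd_def bij_betw_def)
next
  case (insert s S)
  show ?case
  proof (cases "\<exists>v\<in>V. v s \<noteq> 0")
    case False
    then have "v i = 0" if "v \<in> V" "i \<notin> S" for v i
      using insert.prems(2)[of v i] that by (cases "i = s") auto
    then show ?thesis by (intro insert.IH insert.prems(1))
  next
    case True
    then have "\<exists>x\<in>lspan V. integer_point x \<and> x s \<noteq> 0"
      using insert.prems(1) by (auto dest: lspan_base)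
    from integer_point_value_multiple[OF this]
    obtain z where z: "z \<in> lspan V" "integer_point z" "z s > 0"
      and "\<forall>x\<in>lspan V. integer_point x \<longrightarrow> x s / z s \<in> \<int>"
      by (elim bexE conjE)
    then have zdiv: "x s / z s \<in> \<int>" if "x \<in> lspan V" "integer_point x" for x
      using that by simp
    \<comment> \<open>The projection along \<open>z\<close> that kills coordinate \<open>s\<close>.
      It preserves integrality because \<open>x s / z s\<close> is an integer for integer
      points.\<close>
    define \<pi> where "\<pi> = (\<lambda>(x :: 'i \<Rightarrow> real) i. x i - (x s / z s) * z i)"
    have \<pi>_int: "integer_point (\<pi> x)" if "x \<in> lspan V" "integer_point x" for x
      using zdiv[OF that] that(2) z(2) unfolding \<pi>_def integer_point_def by (intro allI Ints_diff Ints_mult) auto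
    have z_out: "z i = 0" if "i \<notin> insert s S" for i
      using lspan_eq_0[OF z(1)] insert.prems(2) that by blast
    have "\<exists>d B. (\<forall>m. integer_point (B m)) \<and>
        bij_betw (\<lambda>c i. \<Sum>m<d. c m * B m i) (Rd d) (lspan (\<pi> ` V)) \<and>
        (\<forall>c\<in>Rd d. integer_point (\<lambda>i. \<Sum>m<d. c m * B m i) \<longrightarrow> c \<in> Zd d)"
    proof (rule insert.IH)
      show "integer_point v" if "v \<in> \<pi> ` V" for v
        using that \<pi>_int[OF lspan_base insert.prems(1)] by blast
      show "v i = 0" if v: "v \<in> \<pi> ` V" and i: "i \<notin> S" for v i
      proof -
        obtain u where u: "u \<in> V" "v = \<pi> u" using v by blast
        show ?thesis
          using z(3) z_out[of i] insert.prems(2)[OF u(1), of i] i unfolding u(2) \<pi>_def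
          by (cases "i = s") auto
      qed
    qed
    then obtain d B where B: "\<forall>m. integer_point (B m)"
      and bij: "bij_betw (\<lambda>c i. \<Sum>m<d. c m * B m i) (Rd d) (lspan (\<pi> ` V))"
      and "\<forall>c\<in>Rd d. integer_point (\<lambda>i. \<Sum>m<d. c m * B m i) \<longrightarrow> c \<in> Zd d"
      by (elim exE conjE)
    then have int: "c \<in> Zd d" if "c \<in> Rd d" "integer_point (\<lambda>i. \<Sum>m<d. c m * B m i)" for c
      using that by simp
    have sub: "lspan (\<pi> ` V) \<subseteq> lspan V"
      using lspan_diff[OF lspan_base z(1)] by (intro lspan_subset) (auto simp: \<pi>_def simp del: times_divide_eq_left)
    have \<pi>_lspan: "\<pi> x \<in> lspan (\<pi> ` V)" if "x \<in> lspan V" for x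
      using that
    proof induction
      case lspan_zero
      then show ?case by (simp add: \<pi>_def lspan.lspan_zero)
    next
      case (lspan_step v x a)
      have "\<pi> (\<lambda>i. a * v i + x i) = (\<lambda>i. a * \<pi> v i + \<pi> x i)"
        by (simp add: \<pi>_def fun_eq_iff algebra_simps add_divide_distrib)
      then show ?case using lspan_step by (simp only:) (blast intro: lspan.lspan_step)
    qed
    have zero_s: "x s = 0" if "x \<in> lspan (\<pi> ` V)" for x
      using z(3) by (intro lspan_eq_0[OF that]) (auto simp: \<pi>_def)
    \<comment> \<open>The point \<open>z\<close> becomes the last basis vector. All other basis
      combinations vanish at \<open>s\<close>, so coordinate \<open>s\<close> of
      \<open>\<psi> c\<close> reads off the coefficient \<open>c d\<close>.\<close>
    define B' where "B' = (\<lambda>m. if m = d then z else B m)"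
    define \<psi> where "\<psi> = (\<lambda>c i. \<Sum>m<Suc d. c m * B' m i)"
    let ?r = "\<lambda>c :: nat \<Rightarrow> real. c(d := 0)"
    let ?\<psi>0 = "\<lambda>c i. \<Sum>m<d. c m * B m i"
    have \<psi>: "\<psi> c i = ?\<psi>0 (?r c) i + c d * z i" for c i
      by (simp add: \<psi>_def B'_def)
    have r: "?r c \<in> Rd d" if "c \<in> Rd (Suc d)" for c
      using that by (auto simp: Rd_def Suc_le_eq)
    have low: "?\<psi>0 (?r c) \<in> lspan (\<pi> ` V)" if "c \<in> Rd (Suc d)" for c
      by (rule bij_betw_apply[OF bij r[OF that]])
    have \<psi>_s: "\<psi> c s = c d * z s" if "c \<in> Rd (Suc d)" for c
      using zero_s[OF low[OF that]] by (simp add: \<psi>)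
    have into: "\<psi> c \<in> lspan V" if "c \<in> Rd (Suc d)" for c
    proof -
      have "(\<lambda>i. ?\<psi>0 (?r c) i + c d * z i) \<in> lspan V"
        using low[OF that] sub by (intro lspan_add lspan_scale z(1)) auto
      then show ?thesis by (simp add: \<psi>[abs_def])
    qed
    have "bij_betw \<psi> (Rd (Suc d)) (lspan V)"
      unfolding bij_betw_def
    proof (intro conjI inj_onI equalityI subsetI)
      fix c e assume ce: "c \<in> Rd (Suc d)" "e \<in> Rd (Suc d)" "\<psi> c = \<psi> e"
      then have d: "c d = e d" using \<psi>_s[OF ce(1)] \<psi>_s[OF ce(2)] z(3) by simp
      have "?\<psi>0 (?r c) i = ?\<psi>0 (?r e) i" for i
        using fun_cong[OF ce(3), of i] d unfolding \<psi> by simp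
      then have "?\<psi>0 (?r c) = ?\<psi>0 (?r e)" by blast
      then have "?r c = ?r e"
        by (rule inj_onD[OF bij_betw_imp_inj_on[OF bij] _ r[OF ce(1)] r[OF ce(2)]])
      then have "c i = e i" for i using d by (cases "i = d") (simp, metis fun_upd_other)
      then show "c = e" by blast
    next
      fix x assume "x \<in> \<psi> ` Rd (Suc d)"
      then show "x \<in> lspan V" using into by blast
    next
      fix x assume x: "x \<in> lspan V"
      from \<pi>_lspan[OF x] have "\<pi> x \<in> ?\<psi>0 ` Rd d" unfolding bij_betw_imp_surj_on[OF bij] .
      then obtain c where c: "\<pi> x = ?\<psi>0 c" "c \<in> Rd d" by (rule imageE)
      have "c(d := x s / z s) \<in> Rd (Suc d)" using c(2) by (auto simp: Rd_def)
      moreover have "x = \<psi> (c(d := x s / z s))"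
      proof
        fix i
        show "x i = \<psi> (c(d := x s / z s)) i"
          using fun_cong[OF c(1), of i] by (simp add: \<psi> \<pi>_def)
      qed
      ultimately show "x \<in> \<psi> ` Rd (Suc d)" by blast
    qed
    moreover have "c \<in> Zd (Suc d)" if c: "c \<in> Rd (Suc d)" "integer_point (\<psi> c)" for c
    proof -
      have cd: "c d \<in> \<int>" using zdiv[OF into[OF c(1)] c(2)] \<psi>_s[OF c(1)] z(3) by simp
      have "?\<psi>0 (?r c) i \<in> \<int>" for i
      proof -
        have "?\<psi>0 (?r c) i = \<psi> c i - c d * z i" unfolding \<psi> by simp
        also have "\<dots> \<in> \<int>" using c(2) cd z(2) unfolding integer_point_def by (intro Ints_diff Ints_mult) auto
        finally show ?thesis .
      qed
      then have "?r c \<in> Zd d" by (intro int r c(1)) (auto simp: integer_point_def)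
      then have "?r c m \<in> \<int>" for m unfolding Zd_def by blast
      then have "c m \<in> \<int>" for m using cd by (cases "m = d") (simp, metis fun_upd_other)
      then show ?thesis using c(1) by (simp add: Zd_def)
    qed
    moreover have "integer_point (B' m)" for m using B z(2) by (simp add: B'_def)
    ultimately show ?thesis
      unfolding \<psi>_def by (intro exI[of _ "Suc d"] exI[of _ B'] conjI allI ballI impI)
  qed
qed

text \<open>The inverse viewpoint to \<open>lattice_iso\<close>: a map from coordinates to points
  can be written as an explicit formula, and its inverse is the required isomorphism.\<close>

definition lattice_param :: "('i \<Rightarrow> real) set \<Rightarrow> nat \<Rightarrow> ((nat \<Rightarrow> real) \<Rightarrow> ('i \<Rightarrow> real)) \<Rightarrow> bool" where
  "lattice_param A d \<psi> \<longleftrightarrow> affine_on (Rd d) \<psi> \<and> bij_betw \<psi> (Rd d) A \<and>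
     (\<forall>c\<in>Rd d. integer_point (\<psi> c) \<longleftrightarrow> c \<in> Zd d)"

lemma Rd_sum: "(\<And>x. x \<in> T \<Longrightarrow> g x \<in> Rd d) \<Longrightarrow> (\<lambda>i. \<Sum>x\<in>T. c x * g x i) \<in> Rd d"
  by (simp add: Rd_def)

text \<open>The inverse of an affine bijection is affine: applying \<open>\<psi>\<close> to a
  combination of coordinate vectors gives the combination of their points, and injectivity of
  \<open>\<psi>\<close> identifies the coordinates.\<close>

lemma lattice_param_iso:
  assumes "lattice_param (aff_hull P) d \<psi>"
  shows "lattice_iso P d (inv_into (Rd d) \<psi>)"
proof -
  let ?A = "aff_hull P" and ?g = "inv_into (Rd d) \<psi>"
  have aff: "affine_on (Rd d) \<psi>" and bij: "bij_betw \<psi> (Rd d) ?A"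
    and int: "\<And>c. c \<in> Rd d \<Longrightarrow> integer_point (\<psi> c) \<longleftrightarrow> c \<in> Zd d"
    using assms by (auto simp: lattice_param_def)
  have g: "bij_betw ?g ?A (Rd d)" by (rule bij_betw_inv_into[OF bij])
  have \<psi>g: "\<psi> (?g x) = x" if "x \<in> ?A" for x by (rule bij_betw_inv_into_right[OF bij that])
  have g\<psi>: "?g (\<psi> c) = c" if "c \<in> Rd d" for c by (rule bij_betw_inv_into_left[OF bij that])
  have gR: "?g x \<in> Rd d" if "x \<in> ?A" for x by (rule bij_betw_apply[OF g that])
  have "affine_on ?A ?g"
    unfolding affine_on_def
  proof (intro allI impI, elim conjE)
    fix T c assume T: "finite T" "T \<subseteq> ?A" "T \<noteq> {}" "sum c T = (1 :: real)"
    have inj: "inj_on ?g T" using bij_betw_imp_inj_on[OF g] T(2) by (rule inj_on_subset)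
    let ?e = "\<lambda>j. \<Sum>x\<in>T. c x * ?g x j"
    have e: "?e \<in> Rd d" using gR T(2) by (intro Rd_sum) auto
    have "?e = (\<lambda>j. \<Sum>y\<in>?g ` T. c (\<psi> y) * y j)"
      using \<psi>g T(2) by (simp add: sum.reindex[OF inj] subset_iff)
    moreover have "\<psi> (\<lambda>j. \<Sum>y\<in>?g ` T. c (\<psi> y) * y j) = (\<lambda>i. \<Sum>y\<in>?g ` T. c (\<psi> y) * \<psi> y i)"
    proof -
      have "sum (\<lambda>y. c (\<psi> y)) (?g ` T) = 1"
        using \<psi>g T(2,4) by (simp add: sum.reindex[OF inj] subset_iff)
      moreover have "?g ` T \<subseteq> Rd d" using gR T(2) by auto
      ultimately show ?thesis
        using aff[unfolded affine_on_def, rule_format, of "?g ` T" "\<lambda>y. c (\<psi> y)"] T(1,3) by simp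
    qed
    moreover have "\<dots> = (\<lambda>i. \<Sum>x\<in>T. c x * x i)"
      using \<psi>g T(2) by (simp add: sum.reindex[OF inj] subset_iff)
    ultimately have "\<psi> ?e = (\<lambda>i. \<Sum>x\<in>T. c x * x i)" by simp
    then show "?g (\<lambda>i. \<Sum>x\<in>T. c x * x i) = ?e" using g\<psi>[OF e] by simp
  qed
  moreover have "?g ` aff_lattice P = Zd d"
  proof (intro equalityI subsetI)
    fix c assume "c \<in> ?g ` aff_lattice P"
    then obtain x where x: "x \<in> ?A" "integer_point x" "c = ?g x"
      by (auto simp: aff_lattice_def integer_point_def)
    then show "c \<in> Zd d" using int[OF gR[OF x(1)]] \<psi>g[OF x(1)] by simp
  next
    fix c assume c: "c \<in> Zd d"
    then have R: "c \<in> Rd d" by (simp add: Zd_def)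
    then have "\<psi> c \<in> aff_lattice P"
      using int[OF R] c bij_betw_apply[OF bij R] by (simp add: aff_lattice_def integer_point_def)
    then show "c \<in> ?g ` aff_lattice P" using g\<psi>[OF R] by (metis imageI)
  qed
  ultimately show ?thesis using g by (simp add: lattice_iso_def)
qed

text \<open>A lattice basis of the span of the differences \<open>v - p\<close> gives the
  coordinates. The point \<open>p\<close> of \<open>V\<close> becomes the origin, so in these
  coordinates the polytope contains the origin.\<close>

lemma lattice_param_exists:
  fixes V :: "('i \<Rightarrow> real) set"
  assumes "finite V" "p \<in> V" "finite S" "\<And>v. v \<in> V \<Longrightarrow> integer_point v"
    "\<And>v i. v \<in> V \<Longrightarrow> i \<notin> S \<Longrightarrow> v i = 0"
  shows "\<exists>d B. (\<forall>m. integer_point (B m)) \<and>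
    lattice_param (aff_hull V) d (\<lambda>c i. p i + (\<Sum>m<d. c m * B m i))"
proof -
  let ?D = "(\<lambda>v i. v i - p i) ` V"
  have "\<exists>d B. (\<forall>m. integer_point (B m)) \<and>
    bij_betw (\<lambda>c i. \<Sum>m<d. c m * B m i) (Rd d) (lspan ?D) \<and>
    (\<forall>c\<in>Rd d. integer_point (\<lambda>i. \<Sum>m<d. c m * B m i) \<longrightarrow> c \<in> Zd d)"
  proof (rule lattice_basis[OF assms(3)])
    show "integer_point u" if "u \<in> ?D" for u
      using that assms(2,4) by (auto simp: integer_point_def)
    show "u i = 0" if "u \<in> ?D" "i \<notin> S" for u i
      using that(1) assms(5)[OF assms(2) that(2)] assms(5)[OF _ that(2)] by auto
  qed
  then obtain d B where B: "\<forall>m. integer_point (B m)"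
    and bij: "bij_betw (\<lambda>c i. \<Sum>m<d. c m * B m i) (Rd d) (lspan ?D)"
    and int: "\<forall>c\<in>Rd d. integer_point (\<lambda>i. \<Sum>m<d. c m * B m i) \<longrightarrow> c \<in> Zd d"
    by (elim exE conjE)
  let ?\<psi> = "\<lambda>c i. p i + (\<Sum>m<d. c m * B m i)"
  have "affine_on (Rd d) ?\<psi>"
    unfolding affine_on_def
  proof (intro allI impI, elim conjE)
    fix T :: "(nat \<Rightarrow> real) set" and c :: "(nat \<Rightarrow> real) \<Rightarrow> real"
    assume T: "finite T" "sum c T = 1"
    have "(\<Sum>m<d. (\<Sum>x\<in>T. c x * x m) * B m i) = (\<Sum>x\<in>T. c x * (\<Sum>m<d. x m * B m i))" for i
      by (simp add: sum_distrib_left sum_distrib_right mult.assoc sum.swap[of _ "{..<d}"])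
    moreover have "(\<Sum>x\<in>T. c x * p i) = p i" for i using T(2) by (simp flip: sum_distrib_right)
    ultimately show "?\<psi> (\<lambda>i. \<Sum>x\<in>T. c x * x i) = (\<lambda>j. \<Sum>x\<in>T. c x * ?\<psi> x j)"
      by (simp add: distrib_left sum.distrib)
  qed
  moreover have "bij_betw ?\<psi> (Rd d) (aff_hull V)"
  proof -
    have "bij_betw (\<lambda>x i. p i + x i) (lspan ?D) (aff_hull V)"
      by (rule bij_betw_byWitness[where f' = "\<lambda>x i. x i - p i"])
        (auto simp: aff_hull_eq_lspan[OF assms(1,2)])
    from bij_betw_trans[OF bij this] show ?thesis by (simp add: comp_def)
  qed
  moreover have "integer_point (?\<psi> c) \<longleftrightarrow> c \<in> Zd d" if c: "c \<in> Rd d" for c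
  proof
    assume *: "integer_point (?\<psi> c)"
    have "(\<Sum>m<d. c m * B m i) \<in> \<int>" for i
    proof -
      have "(\<Sum>m<d. c m * B m i) = ?\<psi> c i - p i" by simp
      also have "\<dots> \<in> \<int>" using * assms(2,4) unfolding integer_point_def by (intro Ints_diff) auto
      finally show ?thesis .
    qed
    then show "c \<in> Zd d" using int c by (simp add: integer_point_def)
  next
    assume "c \<in> Zd d"
    then show "integer_point (?\<psi> c)"
      using B assms(2,4) by (auto simp: Zd_def integer_point_def intro!: Ints_add Ints_sum Ints_mult)
  qed
  ultimately have "lattice_param (aff_hull V) d ?\<psi>" by (simp add: lattice_param_def)
  then show ?thesis using B by (intro exI conjI)
qed

section \<open>Linear forms and splitting a convex hull along a hyperplane\<close>

definition linear_form :: "(('i \<Rightarrow> real) \<Rightarrow> real) \<Rightarrow> bool" where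
  "linear_form f \<longleftrightarrow> (\<forall>x y a. f (\<lambda>i. x i + a * y i) = f x + a * f y)"

lemma linear_form_add: "linear_form f \<Longrightarrow> f (\<lambda>i. x i + a * y i) = f x + a * f y"
  unfolding linear_form_def by blast

lemma linear_form_diff: "linear_form f \<Longrightarrow> f (\<lambda>i. x i - a * y i) = f x - a * f y"
  using linear_form_add[of f x "- a" y] by simp

lemma linear_form_add_sum:
  assumes "linear_form f" "finite K"
  shows "f (\<lambda>i. p i + (\<Sum>k\<in>K. c k * v k i)) = f p + (\<Sum>k\<in>K. c k * f (v k))"
  using assms(2)
proof (induction K rule: finite_induct)
  case (insert k K)
  have "f (\<lambda>i. (p i + (\<Sum>k\<in>K. c k * v k i)) + c k * v k i) = f p + (\<Sum>k\<in>K. c k * f (v k)) + c k * f (v k)"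
    using insert.IH linear_form_add[OF assms(1)] by simp
  then show ?case using insert.hyps by (simp add: ac_simps)
qed simp

lemma linear_form_zero: "linear_form f \<Longrightarrow> f (\<lambda>_. 0) = 0"
  using linear_form_diff[of f "\<lambda>_. 0" 1 "\<lambda>_. 0"] by simp

lemma linear_form_sum:
  "linear_form f \<Longrightarrow> finite K \<Longrightarrow> f (\<lambda>i. \<Sum>k\<in>K. c k * v k i) = (\<Sum>k\<in>K. c k * f (v k))"
  using linear_form_add_sum[of f K "\<lambda>_. 0" c v] linear_form_zero[of f] by simp

lemma conv_hull_drop:
  assumes "finite V" "W \<subseteq> V" "\<And>v. v \<in> V \<Longrightarrow> 0 \<le> c v" "sum c V = 1"
    "\<And>v. v \<in> V - W \<Longrightarrow> c v = (0 :: real)"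
  shows "(\<lambda>i. \<Sum>v\<in>V. c v * v i) \<in> conv_hull W"
proof -
  have "sum c W = 1"
    using sum.mono_neutral_right[OF assms(1,2), of c] assms(4,5) by simp
  moreover have "(\<Sum>v\<in>V. c v * v i) = (\<Sum>v\<in>W. c v * v i)" for i
    using assms(5) by (intro sum.mono_neutral_right[OF assms(1,2)]) auto
  moreover have "\<forall>v\<in>W. 0 \<le> c v" using assms(2,3) by auto
  moreover have "finite W" using assms(1,2) finite_subset by blast
  ultimately show ?thesis unfolding conv_hull_finite[OF \<open>finite W\<close>]
    by (intro CollectI exI[of _ c] conjI ext)
qed

text \<open>Trading mass from a pair of vertices on opposite sides of the hyperplane to a pair on it
  eliminates one of the two sides, one vertex at a time.\<close>

lemma conv_hull_split:
  fixes V :: "('i \<Rightarrow> real) set" and f :: "('i \<Rightarrow> real) \<Rightarrow> real"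
  assumes "finite V"
    and exch: "\<And>u v. u \<in> V \<Longrightarrow> v \<in> V \<Longrightarrow> f u < 0 \<Longrightarrow> 0 < f v \<Longrightarrow>
      \<exists>x\<in>V. \<exists>y\<in>V. f x = 0 \<and> f y = 0 \<and> (\<forall>i. u i + v i = x i + y i)"
    and "y \<in> conv_hull V"
  shows "y \<in> conv_hull {v\<in>V. f v \<le> 0} \<or> y \<in> conv_hull {v\<in>V. 0 \<le> f v}"
proof -
  have "(\<lambda>i. \<Sum>v\<in>V. c v * v i) \<in> conv_hull {v\<in>V. f v \<le> 0} \<or>
      (\<lambda>i. \<Sum>v\<in>V. c v * v i) \<in> conv_hull {v\<in>V. 0 \<le> f v}"
    if "\<And>v. v \<in> V \<Longrightarrow> 0 \<le> c v" "sum c V = 1" for c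
    using that
  \<comment> \<open>The measure counts the vertices off the hyperplane that carry weight.\<close>
  proof (induction "card {v\<in>V. f v \<noteq> 0 \<and> c v \<noteq> 0}" arbitrary: c rule: less_induct)
    case less
    show ?case
    proof (cases "\<exists>u\<in>V. \<exists>v\<in>V. f u < 0 \<and> 0 < f v \<and> c u \<noteq> 0 \<and> c v \<noteq> 0")
      case False
      then have "(\<forall>v\<in>V. f v < 0 \<longrightarrow> c v = 0) \<or> (\<forall>v\<in>V. 0 < f v \<longrightarrow> c v = 0)" by blast
      then show ?thesis
      proof
        assume *: "\<forall>v\<in>V. f v < 0 \<longrightarrow> c v = 0"
        have "(\<lambda>i. \<Sum>v\<in>V. c v * v i) \<in> conv_hull {v\<in>V. 0 \<le> f v}"
          by (rule conv_hull_drop[OF assms(1)]) (use less.prems * in auto)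
        then show ?thesis ..
      next
        assume *: "\<forall>v\<in>V. 0 < f v \<longrightarrow> c v = 0"
        have "(\<lambda>i. \<Sum>v\<in>V. c v * v i) \<in> conv_hull {v\<in>V. f v \<le> 0}"
          by (rule conv_hull_drop[OF assms(1)]) (use less.prems * in auto)
        then show ?thesis ..
      qed
    next
      case True
      then obtain u v where uv: "u \<in> V" "v \<in> V" "f u < 0" "0 < f v" "c u \<noteq> 0" "c v \<noteq> 0" by blast
      from exch[OF uv(1-4)] obtain x y where xy: "x \<in> V" "y \<in> V" "f x = 0" "f y = 0"
        "\<forall>i. u i + v i = x i + y i" by (elim bexE conjE)
      \<comment> \<open>The largest weight that can be moved from \<open>u\<close>, \<open>v\<close>
        to \<open>x\<close>, \<open>y\<close>: at least one of \<open>u\<close>, \<open>v\<close>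
        loses all its weight, while \<open>x\<close> and \<open>y\<close> lie on the hyperplane and
        are not counted. The corrections in \<open>c'\<close> are added one by one so that
        \<open>x = y\<close> is covered too.\<close>
      define m where "m = min (c u) (c v)"
      define c' where "c' = (\<lambda>z. c z + (if z = x then m else 0) + (if z = y then m else 0)
        - (if z = u then m else 0) - (if z = v then m else 0))"
      have ne: "u \<noteq> v" "u \<noteq> x" "u \<noteq> y" "v \<noteq> x" "v \<noteq> y" using uv xy by auto
      have m: "0 < m" "m \<le> c u" "m \<le> c v"
        using uv less.prems(1)[of u] less.prems(1)[of v] by (auto simp: m_def)
      have sum: "(\<Sum>z\<in>V. c' z * g z) = (\<Sum>z\<in>V. c z * g z) + m * (g x + g y - g u - g v)"
        for g :: "('i \<Rightarrow> real) \<Rightarrow> real"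
      proof -
        have "c' z * g z = c z * g z + (if z = x then m * g z else 0) + (if z = y then m * g z else 0)
          - (if z = u then m * g z else 0) - (if z = v then m * g z else 0)" for z
          by (simp add: c'_def algebra_simps)
        then have "(\<Sum>z\<in>V. c' z * g z) = (\<Sum>z\<in>V. c z * g z + (if z = x then m * g z else 0)
          + (if z = y then m * g z else 0) - (if z = u then m * g z else 0)
          - (if z = v then m * g z else 0))" by (intro sum.cong refl)
        also have "\<dots> = (\<Sum>z\<in>V. c z * g z) + m * g x + m * g y - m * g u - m * g v"
          using assms(1) uv xy by (simp add: sum.distrib sum_subtractf)
        finally show ?thesis by (simp add: algebra_simps)
      qed
      have "card {z\<in>V. f z \<noteq> 0 \<and> c' z \<noteq> 0} < card {z\<in>V. f z \<noteq> 0 \<and> c z \<noteq> 0}"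
      proof (rule psubset_card_mono)
        show "finite {z\<in>V. f z \<noteq> 0 \<and> c z \<noteq> 0}" using assms(1) by simp
        have "{z\<in>V. f z \<noteq> 0 \<and> c' z \<noteq> 0} \<subseteq> {z\<in>V. f z \<noteq> 0 \<and> c z \<noteq> 0}"
          using uv xy by (auto simp: c'_def split: if_splits)
        moreover have "c' u = 0 \<or> c' v = 0" using ne by (auto simp: c'_def m_def)
        ultimately show "{z\<in>V. f z \<noteq> 0 \<and> c' z \<noteq> 0} \<subset> {z\<in>V. f z \<noteq> 0 \<and> c z \<noteq> 0}"
          using uv by force
      qed
      moreover have "0 \<le> c' z" if "z \<in> V" for z
        using less.prems(1)[OF that] m ne by (auto simp: c'_def)
      moreover have "sum c' V = 1" using sum[of "\<lambda>_. 1"] less.prems(2) by simp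
      ultimately have "(\<lambda>i. \<Sum>v\<in>V. c' v * v i) \<in> conv_hull {v\<in>V. f v \<le> 0} \<or>
          (\<lambda>i. \<Sum>v\<in>V. c' v * v i) \<in> conv_hull {v\<in>V. 0 \<le> f v}"
        by (rule less.hyps)
      moreover have "(\<Sum>v\<in>V. c' v * v i) = (\<Sum>v\<in>V. c v * v i)" for i
      proof -
        have "x i + y i - u i - v i = 0" using xy(5) by (simp add: algebra_simps)
        then show ?thesis using sum[of "\<lambda>z. z i"] by simp
      qed
      ultimately show ?thesis by simp
    qed
  qed
  then show ?thesis using assms(3) unfolding conv_hull_finite[OF assms(1)] by blast
qed

section \<open>Mutations from an exchange property\<close>

text \<open>Along the segment from 0 to \<open>h\<close> the pairing is
  \<open>t * dotp d h u\<close> with \<open>t\<close> between 0 and 1, so its minimum is attained at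
  an endpoint. This matches the factor \<open>min 0 (f u)\<close> of the piecewise linear
  map.\<close>

lemma INF_dotp_segment:
  "(INF e\<in>conv_hull {\<lambda>_. 0, h}. dotp d e u) = min 0 (dotp d h u)"
proof -
  have elem: "\<exists>t. 0 \<le> t \<and> t \<le> 1 \<and> e = (\<lambda>i. t * h i)" if e: "e \<in> conv_hull {\<lambda>_. 0, h}" for e
  proof -
    \<comment> \<open>The two endpoints are indexed by booleans so that \<open>h = 0\<close> needs
      no separate case.\<close>
    obtain c :: "bool \<Rightarrow> real" where "0 \<le> c False" "0 \<le> c True" "c False + c True = 1"
      "e = (\<lambda>i. c True * h i)"
      using e conv_hull_image[of "UNIV :: bool set" "\<lambda>b. if b then h else (\<lambda>_. 0)"]
      by (auto simp: UNIV_bool insert_commute)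
    then show ?thesis by (intro exI[of _ "c True"]) auto
  qed
  have mem: "(\<lambda>_. 0) \<in> conv_hull {\<lambda>_. 0, h}" "h \<in> conv_hull {\<lambda>_. 0, h}"
    using subset_conv_hull[of "{\<lambda>_. 0, h}"] by auto
  have scale: "dotp d (\<lambda>i. t * h i) u = t * dotp d h u" for t
    by (simp add: dotp_def sum_distrib_left mult.assoc)
  show ?thesis
  proof (rule cInf_eq_minimum)
    show "min 0 (dotp d h u) \<in> (\<lambda>e. dotp d e u) ` conv_hull {\<lambda>_. 0, h}"
      using imageI[OF mem(1), of "\<lambda>e. dotp d e u"] imageI[OF mem(2), of "\<lambda>e. dotp d e u"]
      by (simp add: min_def dotp_def)
    fix r assume "r \<in> (\<lambda>e. dotp d e u) ` conv_hull {\<lambda>_. 0, h}"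
    then obtain t where t: "0 \<le> t" "t \<le> 1" "r = t * dotp d h u" using elem scale by blast
    show "min 0 (dotp d h u) \<le> r"
    proof (cases "0 \<le> dotp d h u")
      case True
      then show ?thesis using t by simp
    next
      case False
      then have "1 * dotp d h u \<le> t * dotp d h u" using t by (intro mult_right_mono_neg) auto
      then show ?thesis using t False by simp
    qed
  qed
qed

text \<open>Here \<open>V\<close> is the vertex set before the mutation, \<open>f\<close> the form
  and \<open>w\<close> the translation vector. The assumption \<open>exch\<close> is the exchange
  before the mutation and \<open>exch'\<close> the one after it: \<open>u i - f u * w i\<close> is
  the translated vertex, as \<open>f u < 0\<close>. The entry 1 of \<open>w\<close> at
  \<open>i0\<close> makes \<open>w\<close> primitive in any lattice of integer points containing
  it.\<close>

locale exchange_mutation =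
  fixes V :: "('i \<Rightarrow> real) set" and S :: "'i set" and f :: "('i \<Rightarrow> real) \<Rightarrow> real"
    and w :: "'i \<Rightarrow> real" and i0 :: 'i
  assumes fin: "finite V" and ne: "V \<noteq> {}" and finS: "finite S"
    and int: "\<And>v. v \<in> V \<Longrightarrow> integer_point v"
    and supp: "\<And>v i. v \<in> V \<Longrightarrow> i \<notin> S \<Longrightarrow> v i = 0"
    and lin: "linear_form f" and f_int: "\<And>x. integer_point x \<Longrightarrow> f x \<in> \<int>" and f_w: "f w = 0"
    and w_int: "integer_point w" and w_i0: "w i0 = 1"
    and exch: "\<And>u v. u \<in> V \<Longrightarrow> v \<in> V \<Longrightarrow> f u < 0 \<Longrightarrow> 0 < f v \<Longrightarrow>
      \<exists>x\<in>V. \<exists>y\<in>V. f x = 0 \<and> f y = 0 \<and> (\<forall>i. u i + v i = x i + y i)"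
    and exch': "\<And>u v. u \<in> V \<Longrightarrow> v \<in> V \<Longrightarrow> f u < 0 \<Longrightarrow> 0 < f v \<Longrightarrow>
      \<exists>x\<in>V. \<exists>y\<in>V. f x = 0 \<and> f y = 0 \<and> (\<forall>i. u i - f u * w i + v i = x i + y i)"
begin

definition \<phi> :: "('i \<Rightarrow> real) \<Rightarrow> 'i \<Rightarrow> real" where
  "\<phi> u = (\<lambda>i. u i - min 0 (f u) * w i)"

text \<open>The linear map that \<open>\<phi>\<close> agrees with on the half-space
  \<open>f u \<le> 0\<close>, extended to the whole space.\<close>

definition \<tau> :: "('i \<Rightarrow> real) \<Rightarrow> 'i \<Rightarrow> real" where
  "\<tau> u = (\<lambda>i. u i - f u * w i)"

lemma \<phi>_nonneg: "0 \<le> f u \<Longrightarrow> \<phi> u = u"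
  by (simp add: \<phi>_def)

lemma \<phi>_nonpos: "f u \<le> 0 \<Longrightarrow> \<phi> u = \<tau> u"
  by (simp add: \<phi>_def \<tau>_def)

lemma f_\<phi>: "f (\<phi> u) = f u"
  by (simp add: \<phi>_def linear_form_diff[OF lin] f_w)

lemma f_\<tau>: "f (\<tau> u) = f u"
  by (simp add: \<tau>_def linear_form_diff[OF lin] f_w)

lemma affine_on_\<tau>: "affine_on A \<tau>"
  unfolding affine_on_def
proof (intro allI impI, elim conjE)
  fix T :: "('i \<Rightarrow> real) set" and c assume T: "finite T"
  show "\<tau> (\<lambda>i. \<Sum>x\<in>T. c x * x i) = (\<lambda>j. \<Sum>x\<in>T. c x * \<tau> x j)"
    using linear_form_sum[OF lin T, of c "\<lambda>x. x"]
    by (simp add: \<tau>_def right_diff_distrib sum_subtractf sum_distrib_right mult.assoc)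
qed

lemma inj_\<tau>: "inj_on \<tau> A"
proof (rule inj_onI)
  fix x y assume *: "\<tau> x = \<tau> y"
  then have "f x = f y" by (metis f_\<tau>)
  then show "x = y" using fun_cong[OF *] by (simp add: \<tau>_def fun_eq_iff)
qed

lemma f_conv_nonneg: "y \<in> conv_hull {v\<in>V. 0 \<le> f v} \<Longrightarrow> 0 \<le> f y"
  using linear_form_sum[OF lin, of _ _ "\<lambda>x. x"] unfolding conv_hull_def
  by (auto intro!: sum_nonneg mult_nonneg_nonneg)

lemma f_conv_nonpos: "y \<in> conv_hull {v\<in>V. f v \<le> 0} \<Longrightarrow> f y \<le> 0"
  using linear_form_sum[OF lin, of _ _ "\<lambda>x. x"] unfolding conv_hull_def
  by (auto intro!: sum_nonpos mult_nonneg_nonpos)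

lemma image_\<phi>_nonpos: "\<phi> ` conv_hull {v\<in>V. f v \<le> 0} = conv_hull (\<phi> ` {v\<in>V. f v \<le> 0})"
proof (cases "{v\<in>V. f v \<le> 0} = {}")
  case True
  then show ?thesis by (simp only: image_empty) (simp add: conv_hull_def)
next
  case False
  have "\<phi> ` conv_hull {v\<in>V. f v \<le> 0} = \<tau> ` conv_hull {v\<in>V. f v \<le> 0}"
    using f_conv_nonpos \<phi>_nonpos by (intro image_cong) auto
  also have "\<dots> = conv_hull (\<tau> ` {v\<in>V. f v \<le> 0})"
    using fin by (intro affine_on_image_conv_hull[OF _ False affine_on_\<tau>]) simp
  also have "\<tau> ` {v\<in>V. f v \<le> 0} = \<phi> ` {v\<in>V. f v \<le> 0}"
    using \<phi>_nonpos by (intro image_cong) auto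
  finally show ?thesis .
qed

lemma image_\<phi>_nonneg: "\<phi> ` conv_hull {v\<in>V. 0 \<le> f v} = conv_hull (\<phi> ` {v\<in>V. 0 \<le> f v})"
proof -
  have "\<phi> ` A = A" if "\<And>v. v \<in> A \<Longrightarrow> 0 \<le> f v" for A
    using that by (force simp: \<phi>_nonneg)
  from this[of "{v\<in>V. 0 \<le> f v}"] this[of "conv_hull {v\<in>V. 0 \<le> f v}"]
  show ?thesis using f_conv_nonneg by simp
qed

text \<open>The map \<open>\<phi>\<close> is not affine, but it is so on each side of the
  hyperplane. By \<open>conv_hull_split\<close> both hulls are the union of the hulls of their
  vertices on either side, where image and hull commute. For the old vertices this uses
  \<open>exch\<close>; for the new ones it uses \<open>exch'\<close> and the invariance of
  \<open>f\<close> under \<open>\<phi>\<close>.\<close>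

lemma image_\<phi>_conv_hull: "\<phi> ` conv_hull V = conv_hull (\<phi> ` V)"
proof (intro equalityI subsetI)
  fix z assume "z \<in> \<phi> ` conv_hull V"
  then obtain y where y: "y \<in> conv_hull V" "z = \<phi> y" by blast
  from conv_hull_split[OF fin exch y(1)]
  have "z \<in> \<phi> ` conv_hull {v\<in>V. f v \<le> 0} \<or> z \<in> \<phi> ` conv_hull {v\<in>V. 0 \<le> f v}"
    using y(2) by blast
  then have "z \<in> conv_hull (\<phi> ` {v\<in>V. f v \<le> 0}) \<or> z \<in> conv_hull (\<phi> ` {v\<in>V. 0 \<le> f v})"
    unfolding image_\<phi>_nonneg image_\<phi>_nonpos .
  moreover have "\<phi> ` {v\<in>V. f v \<le> 0} \<subseteq> \<phi> ` V" "\<phi> ` {v\<in>V. 0 \<le> f v} \<subseteq> \<phi> ` V" by auto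
  ultimately show "z \<in> conv_hull (\<phi> ` V)" using conv_hull_mono by blast
next
  fix z assume z: "z \<in> conv_hull (\<phi> ` V)"
  have "z \<in> conv_hull {v\<in>\<phi> ` V. f v \<le> 0} \<or> z \<in> conv_hull {v\<in>\<phi> ` V. 0 \<le> f v}"
  proof (rule conv_hull_split[OF _ _ z])
    fix u' v' assume "u' \<in> \<phi> ` V" "v' \<in> \<phi> ` V" and f: "f u' < 0" "0 < f v'"
    then obtain u v where uv: "u \<in> V" "v \<in> V" "u' = \<phi> u" "v' = \<phi> v" by blast
    with f have fuv: "f u < 0" "0 < f v" by (simp_all add: f_\<phi>)
    from exch'[OF uv(1,2) fuv] obtain x y where xy: "x \<in> V" "y \<in> V" "f x = 0" "f y = 0"
      "\<forall>i. u i - f u * w i + v i = x i + y i" by (elim bexE conjE)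
    have "\<phi> x = x" "\<phi> y = y" using xy by (simp_all add: \<phi>_nonneg)
    then have "x \<in> \<phi> ` V" "y \<in> \<phi> ` V" using xy by (metis imageI)+
    moreover have "\<forall>i. u' i + v' i = x i + y i" using xy(5) fuv uv by (simp add: \<phi>_def)
    ultimately show "\<exists>x\<in>\<phi> ` V. \<exists>y\<in>\<phi> ` V. f x = 0 \<and> f y = 0 \<and> (\<forall>i. u' i + v' i = x i + y i)"
      using xy(3,4) by (intro bexI[of _ x] bexI[of _ y] conjI)
  qed (use fin in auto)
  moreover have "{v\<in>\<phi> ` V. f v \<le> 0} = \<phi> ` {v\<in>V. f v \<le> 0}"
    "{v\<in>\<phi> ` V. 0 \<le> f v} = \<phi> ` {v\<in>V. 0 \<le> f v}" by (auto simp: f_\<phi>)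
  ultimately have "z \<in> \<phi> ` conv_hull {v\<in>V. f v \<le> 0} \<or> z \<in> \<phi> ` conv_hull {v\<in>V. 0 \<le> f v}"
    by (simp only: image_\<phi>_nonneg image_\<phi>_nonpos)
  moreover have "conv_hull {v\<in>V. f v \<le> 0} \<subseteq> conv_hull V" "conv_hull {v\<in>V. 0 \<le> f v} \<subseteq> conv_hull V"
    by (intro conv_hull_mono; blast)+
  ultimately show "z \<in> \<phi> ` conv_hull V" by blast
qed

section \<open>Lattice coordinates for the step, by the signs of the form\<close>

lemma lattice_param_V:
  assumes "p \<in> V"
  shows "\<exists>d B. (\<forall>m. integer_point (B m)) \<and>
    lattice_param (aff_hull V) d (\<lambda>c i. p i + (\<Sum>m<d. c m * B m i))"
  by (rule lattice_param_exists[OF fin assms finS]) (fact int, fact supp)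

lemma step_if_nonneg:
  assumes "\<And>v. v \<in> V \<Longrightarrow> 0 \<le> f v"
  shows "mutation_step (conv_hull V) (conv_hull (\<phi> ` V))"
proof -
  obtain p where "p \<in> V" using ne by blast
  from lattice_param_V[OF this]
  obtain d B where "lattice_param (aff_hull V) d (\<lambda>c i. p i + (\<Sum>m<d. c m * B m i))" (is "lattice_param _ _ ?\<psi>")
    by (elim exE conjE)
  then have iso: "lattice_iso (conv_hull V) d (inv_into (Rd d) ?\<psi>)"
    by (intro lattice_param_iso) (simp add: aff_hull_conv_hull[OF fin])
  have "\<phi> ` V = V" using assms by (force simp: \<phi>_nonneg)
  moreover have "mutation_step (conv_hull V) (conv_hull V)"
    unfolding mutation_step_def using iso by (intro exI conjI disjI1) (assumption | rule refl)+
  ultimately show ?thesis by (simp only:)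
qed

text \<open>On all of \<open>V\<close> the map \<open>\<phi>\<close> is the linear map
  \<open>\<tau>\<close>, which is invertible over the integers. Coordinates of the new polytope are
  obtained by composing those of the old one with \<open>\<tau>\<close>, so the two coordinate
  images coincide.\<close>

lemma step_if_nonpos:
  assumes "\<And>v. v \<in> V \<Longrightarrow> f v \<le> 0"
  shows "mutation_step (conv_hull V) (conv_hull (\<phi> ` V))"
proof -
  obtain p where "p \<in> V" using ne by blast
  from lattice_param_V[OF this]
  obtain d B where B: "lattice_param (aff_hull V) d (\<lambda>c i. p i + (\<Sum>m<d. c m * B m i))"
    by (elim exE conjE)
  define \<psi> where "\<psi> = (\<lambda>c i. p i + (\<Sum>m<d. c m * B m i))"
  have \<psi>: "lattice_param (aff_hull V) d \<psi>" unfolding \<psi>_def by (rule B)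
  then have aff: "affine_on (Rd d) \<psi>" and bij: "bij_betw \<psi> (Rd d) (aff_hull V)"
    and psi_int: "\<And>c. c \<in> Rd d \<Longrightarrow> integer_point (\<psi> c) \<longleftrightarrow> c \<in> Zd d"
    by (auto simp: lattice_param_def)
  have Q: "\<phi> ` V = \<tau> ` V" using assms \<phi>_nonpos by (intro image_cong) auto
  have affQ: "aff_hull (conv_hull (\<tau> ` V)) = \<tau> ` aff_hull V"
    using fin by (simp add: aff_hull_conv_hull affine_on_image_aff_hull[OF fin ne affine_on_\<tau>])
  have bij': "bij_betw (\<tau> \<circ> \<psi>) (Rd d) (\<tau> ` aff_hull V)"
    using bij inj_\<tau> by (rule bij_betw_trans[OF _ inj_on_imp_bij_betw])
  have \<tau>_integer: "integer_point (\<tau> x) \<longleftrightarrow> integer_point x" for x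
  proof
    assume "integer_point x"
    then show "integer_point (\<tau> x)" using f_int[of x] w_int
      unfolding integer_point_def \<tau>_def by (intro allI Ints_diff Ints_mult) auto
  next
    assume *: "integer_point (\<tau> x)"
    \<comment> \<open>Since \<open>f\<close> is invariant under \<open>\<tau>\<close>, adding back
      \<open>f (\<tau> x) * w\<close> inverts \<open>\<tau>\<close>, again with integer
      coefficients.\<close>
    have "x i = \<tau> x i + f (\<tau> x) * w i" for i unfolding f_\<tau> by (simp add: \<tau>_def)
    moreover have "\<tau> x i + f (\<tau> x) * w i \<in> \<int>" for i
      using * f_int[OF *] w_int unfolding integer_point_def by (intro Ints_add Ints_mult) auto
    ultimately show "integer_point x" unfolding integer_point_def by simp
  qed
  have "affine_on (Rd d) (\<tau> \<circ> \<psi>)"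
    unfolding affine_on_def
  proof (intro allI impI, elim conjE)
    fix T c assume T: "finite T" "T \<subseteq> Rd d" "T \<noteq> {}" "sum c T = (1 :: real)"
    have *: "\<psi> (\<lambda>i. \<Sum>x\<in>T. c x * x i) = (\<lambda>j. \<Sum>x\<in>T. c x * \<psi> x j)"
      using aff T unfolding affine_on_def by simp
    show "(\<tau> \<circ> \<psi>) (\<lambda>i. \<Sum>x\<in>T. c x * x i) = (\<lambda>j. \<Sum>x\<in>T. c x * (\<tau> \<circ> \<psi>) x j)"
      unfolding comp_def *
      by (simp add: \<tau>_def linear_form_sum[OF lin T(1)] right_diff_distrib sum_subtractf
          sum_distrib_right mult.assoc)
  qed
  then have "lattice_param (aff_hull (conv_hull (\<tau> ` V))) d (\<tau> \<circ> \<psi>)"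
    using bij' psi_int \<tau>_integer by (simp add: lattice_param_def affQ)
  then have iso': "lattice_iso (conv_hull (\<tau> ` V)) d (inv_into (Rd d) (\<tau> \<circ> \<psi>))"
    by (rule lattice_param_iso)
  have iso: "lattice_iso (conv_hull V) d (inv_into (Rd d) \<psi>)"
    using \<psi> by (intro lattice_param_iso) (simp add: aff_hull_conv_hull[OF fin])
  have "inv_into (Rd d) (\<tau> \<circ> \<psi>) (\<tau> x) = inv_into (Rd d) \<psi> x" if "x \<in> conv_hull V" for x
  proof -
    have "x \<in> aff_hull V" using that conv_hull_subset_aff_hull by blast
    then obtain c where "c \<in> Rd d" "x = \<psi> c" using bij unfolding bij_betw_def by blast
    then show ?thesis
      using bij_betw_inv_into_left[OF bij' \<open>c \<in> Rd d\<close>] bij_betw_inv_into_left[OF bij \<open>c \<in> Rd d\<close>] by simp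
  qed
  then have "inv_into (Rd d) \<psi> ` conv_hull V = inv_into (Rd d) (\<tau> \<circ> \<psi>) ` conv_hull (\<tau> ` V)"
    unfolding affine_on_image_conv_hull[OF fin ne affine_on_\<tau>, symmetric]
    by (simp add: image_image cong: image_cong)
  then show ?thesis unfolding mutation_step_def Q using iso iso' by (intro exI conjI disjI1)
qed

text \<open>Comparing the two exchanges of \<open>u\<close> and \<open>v\<close> shows that
  \<open>w\<close> is a sum of differences of vertices. Hence both polytopes have the same affine
  hull and one coordinate map \<open>g\<close> serves for both; in these coordinates
  \<open>\<phi>\<close> becomes the tropical map of a segment.\<close>

lemma step_if_mixed:
  assumes u: "u \<in> V" "f u < 0" and v: "v \<in> V" "0 < f v" and fu: "f u = - 1"
  shows "mutation_step (conv_hull V) (conv_hull (\<phi> ` V))"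
proof -
  from exch[OF u(1) v(1) u(2) v(2)] obtain p q where pq: "p \<in> V" "q \<in> V" "f p = 0" "f q = 0"
    "\<forall>i. u i + v i = p i + q i" by (elim bexE conjE)
  from exch'[OF u(1) v(1) u(2) v(2)] obtain p' q' where pq': "p' \<in> V" "q' \<in> V" "f p' = 0" "f q' = 0"
    "\<forall>i. u i - f u * w i + v i = p' i + q' i" by (elim bexE conjE)
  \<comment> \<open>The second exchange minus the first leaves \<open>- f u * w\<close>, and
    \<open>f u = - 1\<close>.\<close>
  have w: "w i = (p' i - p i) + (q' i - q i)" for i
    using pq(5)[rule_format, of i] pq'(5)[rule_format, of i] fu by simp
  have fin': "finite (\<phi> ` V)" using fin by simp
  have shift: "(\<lambda>i. x i + a * w i) \<in> aff_hull W"
    if "x \<in> aff_hull W" "finite W" "p \<in> aff_hull W" "q \<in> aff_hull W" "p' \<in> aff_hull W" "q' \<in> aff_hull W" for x a W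
  proof -
    have "(\<lambda>i. (x i + a * (p' i - p i)) + a * (q' i - q i)) \<in> aff_hull W"
      using that by (intro aff_hull_translate)
    then show ?thesis by (simp add: w algebra_simps)
  qed
  have inA: "x \<in> aff_hull W" if "x \<in> W" for x :: "'i \<Rightarrow> real" and W
    using that subset_conv_hull conv_hull_subset_aff_hull by blast
  have fixed: "x \<in> \<phi> ` V" if "x \<in> V" "0 \<le> f x" for x
    using that \<phi>_nonneg[OF that(2)] by (metis imageI)
  have \<phi>V: "\<phi> x \<in> aff_hull V" if "x \<in> aff_hull V" for x
    using shift[OF that fin, of "- min 0 (f x)"] inA pq pq' by (simp add: \<phi>_def)
  \<comment> \<open>The points \<open>p\<close>, \<open>q\<close>, \<open>p'\<close>,
    \<open>q'\<close> lie on the hyperplane, so they belong to both vertex sets, and both affine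
    hulls are closed under translation by multiples of \<open>w\<close>.\<close>
  have "aff_hull (\<phi> ` V) = aff_hull V"
  proof (rule equalityI)
    show "aff_hull (\<phi> ` V) \<subseteq> aff_hull V"
      unfolding aff_hull_subset_iff[OF fin] using \<phi>V inA by blast
    show "aff_hull V \<subseteq> aff_hull (\<phi> ` V)"
      unfolding aff_hull_subset_iff[OF fin']
    proof
      fix x assume x: "x \<in> V"
      have "(\<lambda>i. \<phi> x i + min 0 (f x) * w i) \<in> aff_hull (\<phi> ` V)"
        using x fixed pq pq' by (intro shift inA fin' imageI) auto
      then show "x \<in> aff_hull (\<phi> ` V)" by (simp add: \<phi>_def)
    qed
  qed
  then have affQ: "aff_hull (conv_hull (\<phi> ` V)) = aff_hull V" by (simp add: aff_hull_conv_hull fin)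
  \<comment> \<open>The base point is \<open>p\<close> because \<open>f p = 0\<close>: then
    \<open>f\<close> has no constant term in the coordinates and is the pairing with an integer
    vector \<open>h\<close>.\<close>
  from lattice_param_V[OF pq(1)]
  obtain d B where B: "\<forall>m. integer_point (B m)"
    and param: "lattice_param (aff_hull V) d (\<lambda>c i. p i + (\<Sum>m<d. c m * B m i))"
    by (elim exE conjE)
  define \<psi> where "\<psi> = (\<lambda>c i. p i + (\<Sum>m<d. c m * B m i))"
  have \<psi>: "lattice_param (aff_hull V) d \<psi>" unfolding \<psi>_def by (rule param)
  then have bij: "bij_betw \<psi> (Rd d) (aff_hull V)"
    and psi_int: "\<And>c. c \<in> Rd d \<Longrightarrow> integer_point (\<psi> c) \<longleftrightarrow> c \<in> Zd d"
    by (auto simp: lattice_param_def)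
  define g where "g = inv_into (Rd d) \<psi>"
  have \<psi>g: "\<psi> (g x) = x" and gR: "g x \<in> Rd d" if "x \<in> aff_hull V" for x
    unfolding g_def using bij_betw_inv_into_right[OF bij that]
      bij_betw_apply[OF bij_betw_inv_into[OF bij] that] by auto
  have g\<psi>: "g (\<psi> c) = c" if "c \<in> Rd d" for c
    unfolding g_def by (rule bij_betw_inv_into_left[OF bij that])
  have iso: "lattice_iso (conv_hull V) d g" "lattice_iso (conv_hull (\<phi> ` V)) d g"
    unfolding g_def using \<psi> by (auto intro!: lattice_param_iso simp: affQ aff_hull_conv_hull[OF fin])
  have g_aff: "affine_on (aff_hull V) g"
    using iso(1) by (simp add: lattice_iso_def aff_hull_conv_hull[OF fin])
  have VA: "V \<subseteq> aff_hull V" "\<phi> ` V \<subseteq> aff_hull V" using \<phi>V inA by auto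
  have gP: "g ` conv_hull V = conv_hull (g ` V)"
    by (rule affine_on_image_conv_hull[OF fin ne affine_on_subset[OF g_aff VA(1)]])
  have gQ: "g ` conv_hull (\<phi> ` V) = conv_hull (g ` \<phi> ` V)"
    using ne by (intro affine_on_image_conv_hull[OF fin' _ affine_on_subset[OF g_aff VA(2)]]) simp
  have gZ: "g x \<in> Zd d" if "x \<in> aff_hull V" "integer_point x" for x
    using psi_int[OF gR[OF that(1)]] \<psi>g[OF that(1)] that(2) by simp
  \<comment> \<open>The coordinates of the vector \<open>w\<close>, measured as a displacement from
    the origin \<open>p\<close>.\<close>
  define \<omega> where "\<omega> = g (\<lambda>i. p i + 1 * w i)"
  have pw: "(\<lambda>i. p i + 1 * w i) \<in> aff_hull V"
    using inA pq pq' by (intro shift fin) auto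
  have \<omega>Z: "\<omega> \<in> Zd d"
    unfolding \<omega>_def using int[OF pq(1)] w_int by (intro gZ pw) (auto simp: integer_point_def)
  then have \<omega>R: "\<omega> \<in> Rd d" by (simp add: Zd_def)
  have \<omega>: "(\<Sum>m<d. \<omega> m * B m i) = w i" for i
    using fun_cong[OF \<psi>g[OF pw], of i] unfolding \<omega>_def[symmetric] by (simp add: \<psi>_def)
  \<comment> \<open>The values of \<open>f\<close> on the basis vectors, cut off at \<open>d\<close>
    so that \<open>h\<close> lies in \<open>Rd d\<close>.\<close>
  define h where "h = (\<lambda>m. if m < d then f (B m) else 0)"
  have hZ: "h \<in> Zd d" using B f_int by (auto simp: h_def Zd_def Rd_def)
  have f\<psi>: "f (\<psi> c) = dotp d h c" for c
    using linear_form_add_sum[OF lin, of "{..<d}" p c B] pq(3)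
    by (simp add: \<psi>_def dotp_def h_def mult.commute)
  have h\<omega>: "dotp d h \<omega> = 0"
  proof -
    have "dotp d h \<omega> = f (\<psi> \<omega>)" by (simp add: f\<psi>)
    also have "\<psi> \<omega> = (\<lambda>i. p i + 1 * w i)" unfolding \<omega>_def by (rule \<psi>g[OF pw])
    also have "f \<dots> = 0" using linear_form_add[OF lin, of p 1 w] pq(3) f_w by simp
    finally show ?thesis .
  qed
  have prim: "primitive d \<omega>"
    unfolding primitive_def
  proof (intro conjI ballI allI impI)
    show "\<omega> \<in> Zd d" by (rule \<omega>Z)
    show "\<omega> \<noteq> (\<lambda>_. 0)" using \<omega>[of i0] w_i0 by auto
    fix x m assume x: "x \<in> Zd d" "\<omega> = (\<lambda>i. of_int m * x i)"
    have "(\<Sum>m<d. x m * B m i0) \<in> \<int>"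
      using x(1) B by (auto simp: Zd_def integer_point_def)
    then obtain k where k: "(\<Sum>m<d. x m * B m i0) = of_int k" by (rule Ints_cases)
    \<comment> \<open>If \<open>\<omega>\<close> is \<open>m\<close> times an integer vector, the
      entry 1 of \<open>w\<close> at \<open>i0\<close> is \<open>m\<close> times an integer.\<close>
    have "of_int m * (\<Sum>m<d. x m * B m i0) = w i0"
      using \<omega>[of i0] unfolding x(2) by (simp add: sum_distrib_left mult.assoc)
    then have "m * k = 1" using w_i0 unfolding k by (metis of_int_1 of_int_eq_iff of_int_mult)
    then show "m = 1 \<or> m = - 1" by (auto simp: zmult_eq_1_iff)
  qed
  define F where "F = conv_hull {\<lambda>_. 0, h}"
  have trop: "trop_map d \<omega> F c = (\<lambda>i. c i - min 0 (f (\<psi> c)) * \<omega> i)" for c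
    by (simp add: trop_map_def F_def INF_dotp_segment f\<psi>)
  have g\<phi>: "g (\<phi> x) = trop_map d \<omega> F (g x)" if x: "x \<in> aff_hull V" for x
  proof -
    have "\<psi> (trop_map d \<omega> F (g x)) = \<phi> (\<psi> (g x))"
      unfolding trop \<phi>_def by (simp add: \<psi>_def left_diff_distrib sum_subtractf mult.assoc \<omega> add_diff_eq
          flip: sum_distrib_left)
    then have "\<psi> (trop_map d \<omega> F (g x)) = \<phi> x" by (simp add: \<psi>g[OF x])
    moreover have "trop_map d \<omega> F (g x) \<in> Rd d" using gR[OF x] \<omega>R by (simp add: trop Rd_def)
    ultimately show ?thesis using g\<psi> by metis
  qed
  have Q: "g ` conv_hull (\<phi> ` V) = trop_map d \<omega> F ` (g ` conv_hull V)"
    unfolding image_\<phi>_conv_hull[symmetric] image_image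
    using g\<phi> conv_hull_subset_aff_hull by (intro image_cong) auto
  have "comb_mutation d (g ` conv_hull V) (g ` conv_hull (\<phi> ` V))"
    unfolding comb_mutation_def
  proof (intro conjI exI)
    show "lattice_polytope d (g ` conv_hull V)"
      unfolding lattice_polytope_def gP using fin ne gZ int VA(1)
      by (intro exI[of _ "g ` V"]) auto
    have "g p = (\<lambda>_. 0)" using g\<psi>[of "\<lambda>_. 0"] by (simp add: \<psi>_def Rd_def)
    then show "(\<lambda>_. 0) \<in> g ` conv_hull V" using pq(1) subset_conv_hull by (metis imageI subsetD)
    show "primitive d \<omega>" by (rule prim)
    show "lattice_polytope d F"
      unfolding lattice_polytope_def F_def using hZ
      by (intro exI[of _ "{\<lambda>_. 0, h}"]) (auto simp: Zd_def Rd_def)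
    show "\<forall>e\<in>F. dotp d e \<omega> = 0"
    proof
      fix e assume "e \<in> F"
      then obtain T c where T: "finite T" "T \<subseteq> {\<lambda>_. 0, h}" "e = (\<lambda>i. \<Sum>x\<in>T. c x * x i)"
        unfolding F_def conv_hull_def by blast
      have "dotp d e \<omega> = (\<Sum>x\<in>T. c x * dotp d x \<omega>)"
        unfolding dotp_def T(3) by (simp add: sum_distrib_right sum_distrib_left mult.assoc sum.swap[of _ T])
      also have "\<dots> = 0" using T(2) h\<omega> by (intro sum.neutral) (auto simp: dotp_def)
      finally show "dotp d e \<omega> = 0" .
    qed
    show "g ` conv_hull (\<phi> ` V) = trop_map d \<omega> F ` (g ` conv_hull V)" by (rule Q)
    show "is_convex (trop_map d \<omega> F ` (g ` conv_hull V))"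
      \<comment> \<open>Convexity holds because the image is the hull of the new vertices in
        coordinates.\<close>
      unfolding Q[symmetric] gQ using fin by (intro is_convex_conv_hull) simp
  qed
  then show ?thesis unfolding mutation_step_def using iso by (intro exI conjI disjI2)
qed

lemma mutation_step_conv_hull:
  assumes "\<And>v. v \<in> V \<Longrightarrow> f v \<in> {-1, 0, 1}"
  shows "mutation_step (conv_hull V) (conv_hull (\<phi> ` V))"
proof (cases "(\<exists>u\<in>V. f u < 0) \<and> (\<exists>v\<in>V. 0 < f v)")
  case True
  then obtain u v where uv: "u \<in> V" "f u < 0" "v \<in> V" "0 < f v" by blast
  then have "f u = - 1" using assms[of u] by auto
  with uv show ?thesis using assms by (intro step_if_mixed)
next
  case False
  then show ?thesis using step_if_nonneg step_if_nonpos by (meson not_less)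
qed

end

section \<open>Matching fields given by column orders\<close>

text \<open>The entries \<open>is ! 0\<close> and \<open>is ! 1\<close> are the two smallest
  elements of \<open>I\<close>. Only the order that \<open>\<kappa>\<close> induces on the columns
  matters, so its values can be chosen for convenience.\<close>

definition order_field :: "(nat \<Rightarrow> nat) \<Rightarrow> nat set \<Rightarrow> nat \<Rightarrow> nat" where
  "order_field \<kappa> I = (let is = sorted_list_of_set I
     in if \<kappa> (is ! 0) < \<kappa> (is ! 1) then id else Transposition.transpose 1 2)"

text \<open>A triple \<open>(x, y, R)\<close> encodes the \<open>k\<close>-subset \<open>{x, y} \<union> R\<close> whose two smallest elements \<open>x\<close> and \<open>y\<close>,
  in either order, occupy rows 1 and 2.\<close>

definition tri_vertex :: "nat \<Rightarrow> nat \<Rightarrow> nat \<Rightarrow> nat set \<Rightarrow> nat \<times> nat \<Rightarrow> real" where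
  "tri_vertex k x y R = (\<lambda>(a, b). if a = 1 then of_bool (b = x) else if a = 2 then of_bool (b = y)
     else of_bool (3 \<le> a \<and> a \<le> k \<and> b = sorted_list_of_set R ! (a - 3)))"

definition triples :: "nat \<Rightarrow> nat \<Rightarrow> (nat \<Rightarrow> nat) \<Rightarrow> (nat \<times> nat \<times> nat set) set" where
  "triples k n \<kappa> = {(x, y, R). x \<in> {1..n} \<and> y \<in> {1..n} \<and> \<kappa> x < \<kappa> y \<and> R \<subseteq> {1..n} \<and>
     card R + 2 = k \<and> (\<forall>r\<in>R. x < r \<and> y < r)}"

lemma sorted_list_of_set_insert_least:
  assumes "finite A" "\<forall>a\<in>A. x < a"
  shows "sorted_list_of_set (insert (x :: nat) A) = x # sorted_list_of_set A"
proof -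
  have "x \<notin> A" using assms(2) by blast
  then have "sorted_wrt (<) (x # sorted_list_of_set A) \<and> set (x # sorted_list_of_set A) = insert x A
      \<and> length (x # sorted_list_of_set A) = card (insert x A)"
    using assms by simp
  then show ?thesis using assms(1) by (subst (asm) sorted_list_of_set_unique) auto
qed

lemma sorted_list_of_set_insert_two:
  assumes "(i :: nat) < j" "finite R" "\<forall>r\<in>R. j < r"
  shows "sorted_list_of_set (insert i (insert j R)) = i # j # sorted_list_of_set R"
proof -
  have "\<forall>r\<in>insert j R. i < r" using assms by auto
  then have "sorted_list_of_set (insert i (insert j R)) = i # sorted_list_of_set (insert j R)"
    using assms(2) by (intro sorted_list_of_set_insert_least) auto
  also have "sorted_list_of_set (insert j R) = j # sorted_list_of_set R"
    using assms(2,3) by (rule sorted_list_of_set_insert_least)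
  finally show ?thesis .
qed

lemma k_subset_cases:
  assumes "I \<in> k_subsets k n" "2 \<le> k"
  obtains i j R where "I = insert i (insert j R)" "i < j" "j \<le> n" "1 \<le> i" "R \<subseteq> {1..n}"
    "card R + 2 = k" "\<forall>r\<in>R. j < r"
proof -
  have I: "I \<subseteq> {1..n}" "card I = k" "finite I"
    using assms(1) finite_subset[of I "{1..n}"] by (auto simp: k_subsets_def)
  define i where "i = Min I"
  have "I \<noteq> {}" using I assms(2) by auto
  then have i: "i \<in> I" "\<forall>r\<in>I. i \<le> r" using I(3) by (auto simp: i_def)
  define I' where "I' = I - {i}"
  have card': "card I' = k - 1" "finite I'" using I i by (auto simp: I'_def)
  define j where "j = Min I'"
  have "I' \<noteq> {}" using card' assms(2) by auto
  then have j: "j \<in> I'" "\<forall>r\<in>I'. j \<le> r" using card'(2) by (auto simp: j_def)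
  have "I = insert i (insert j (I' - {j}))" using i j by (auto simp: I'_def)
  moreover have "i < j" using i j by (auto simp: I'_def intro: le_neq_implies_less)
  moreover have "card (I' - {j}) + 2 = k" using card' j assms(2) by simp
  moreover have "\<forall>r\<in>I' - {j}. j < r" using j(2) by (auto intro: le_neq_implies_less)
  moreover have "j \<le> n" "1 \<le> i" "I' - {j} \<subseteq> {1..n}" using i j I(1) by (auto simp: I'_def)
  ultimately show ?thesis using that by blast
qed

lemma mf_vertex_order_field:
  assumes "i < j" "finite R" "card R + 2 = k" "\<forall>r\<in>R. j < r"
  shows "mf_vertex k (order_field \<kappa>) (insert i (insert j R)) =
    (if \<kappa> i < \<kappa> j then tri_vertex k i j R else tri_vertex k j i R)"
proof -
  let ?L = "i # j # sorted_list_of_set R"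
  have L: "sorted_list_of_set (insert i (insert j R)) = ?L"
    by (rule sorted_list_of_set_insert_two[OF assms(1,2,4)])
  define \<sigma> where "\<sigma> = order_field \<kappa> (insert i (insert j R))"
  have \<sigma>: "\<sigma> = (if \<kappa> i < \<kappa> j then id else Transposition.transpose 1 2)"
    by (simp add: \<sigma>_def order_field_def L)
  \<comment> \<open>In both cases \<open>\<sigma>\<close> is an involution, so the position
    \<open>r\<close> belonging to row \<open>a\<close> is \<open>\<sigma> a\<close>.\<close>
  have inv: "a = \<sigma> r \<longleftrightarrow> r = \<sigma> a" for a r
    unfolding \<sigma> by (auto simp: Transposition.transpose_def)
  have "(\<exists>r\<in>{1..k}. a = \<sigma> r \<and> Q r) \<longleftrightarrow> \<sigma> a \<in> {1..k} \<and> Q (\<sigma> a)" for a Q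
    by (auto simp: inv[of a])
  then have "mf_vertex k (order_field \<kappa>) (insert i (insert j R)) =
      (\<lambda>(a, b). of_bool (\<sigma> a \<in> {1..k} \<and> b = ?L ! (\<sigma> a - 1)))"
    unfolding mf_vertex_def L \<sigma>_def[symmetric] by (simp only: of_bool_def)
  also have "\<dots> = (if \<kappa> i < \<kappa> j then tri_vertex k i j R else tri_vertex k j i R)"
  proof
    fix ab :: "nat \<times> nat"
    obtain a b where ab: "ab = (a, b)" by (cases ab)
    consider "a = 0" | "a = 1" | "a = 2" | c where "a = Suc (Suc (Suc c))"
      by (metis One_nat_def Suc_1 not0_implies_Suc)
    then show "(case ab of (a, b) \<Rightarrow> of_bool (\<sigma> a \<in> {1..k} \<and> b = ?L ! (\<sigma> a - 1))) =
      (if \<kappa> i < \<kappa> j then tri_vertex k i j R else tri_vertex k j i R) ab"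
      using assms(3) unfolding ab
      by cases (auto simp: \<sigma> tri_vertex_def Transposition.transpose_def)
  qed
  finally show ?thesis .
qed

text \<open>Injectivity of \<open>\<kappa>\<close> excludes ties, so for each
  \<open>k\<close>-subset exactly one order of its two smallest elements gives a triple.\<close>

lemma mf_vertex_image_order_field:
  assumes "2 \<le> k" "inj_on \<kappa> {1..n}"
  shows "mf_vertex k (order_field \<kappa>) ` k_subsets k n =
    (\<lambda>(x, y, R). tri_vertex k x y R) ` triples k n \<kappa>"
proof (intro equalityI subsetI)
  fix v assume "v \<in> mf_vertex k (order_field \<kappa>) ` k_subsets k n"
  then obtain I where I: "I \<in> k_subsets k n" "v = mf_vertex k (order_field \<kappa>) I" by blast
  obtain i j R where ij: "I = insert i (insert j R)" "i < j" "j \<le> n" "1 \<le> i" "R \<subseteq> {1..n}"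
    "card R + 2 = k" "\<forall>r\<in>R. j < r" by (rule k_subset_cases[OF I(1) assms(1)])
  have v: "v = (if \<kappa> i < \<kappa> j then tri_vertex k i j R else tri_vertex k j i R)"
    unfolding I(2) ij(1) using ij finite_subset[OF ij(5)] by (intro mf_vertex_order_field) auto
  have "\<kappa> i \<noteq> \<kappa> j" using inj_onD[OF assms(2), of i j] ij by auto
  then show "v \<in> (\<lambda>(x, y, R). tri_vertex k x y R) ` triples k n \<kappa>"
    using v ij by (intro image_eqI[of _ _ "if \<kappa> i < \<kappa> j then (i, j, R) else (j, i, R)"])
      (auto simp: triples_def)
next
  fix v assume "v \<in> (\<lambda>(x, y, R). tri_vertex k x y R) ` triples k n \<kappa>"
  then obtain x y R where t: "x \<in> {1..n}" "y \<in> {1..n}" "\<kappa> x < \<kappa> y" "R \<subseteq> {1..n}"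
    "card R + 2 = k" "\<forall>r\<in>R. x < r \<and> y < r" "v = tri_vertex k x y R"
    by (auto simp: triples_def)
  have fin: "finite R" using t(4) finite_subset by blast
  have "x \<noteq> y" "x \<notin> R" "y \<notin> R" using t(3,6) by auto
  then have "insert x (insert y R) \<in> k_subsets k n"
    using t fin by (simp add: k_subsets_def)
  moreover have "mf_vertex k (order_field \<kappa>) (insert x (insert y R)) = v"
  proof (cases "x < y")
    case True
    then show ?thesis using mf_vertex_order_field[of x y R k \<kappa>] t fin by simp
  next
    case False
    then have "y < x" using \<open>x \<noteq> y\<close> by simp
    then show ?thesis using mf_vertex_order_field[of y x R k \<kappa>] t fin by (simp add: insert_commute)
  qed
  ultimately show "v \<in> mf_vertex k (order_field \<kappa>) ` k_subsets k n" by blast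
qed

lemma matching_field_order_field: "2 \<le> k \<Longrightarrow> matching_field k n (order_field \<kappa>)"
  unfolding matching_field_def order_field_def Let_def
  by (auto intro!: permutes_id permutes_swap_id)

lemma order_field_cong:
  assumes "2 \<le> k" "\<And>x y. x \<in> {1..n} \<Longrightarrow> y \<in> {1..n} \<Longrightarrow> \<kappa> x < \<kappa> y \<longleftrightarrow> \<kappa>' x < \<kappa>' y"
  shows "mf_polytope k n (order_field \<kappa>) = mf_polytope k n (order_field \<kappa>')"
proof -
  have "order_field \<kappa> I = order_field \<kappa>' I" if "I \<in> k_subsets k n" for I
  proof -
    have I: "I \<subseteq> {1..n}" "card I = k" "finite I"
      using that finite_subset[of I "{1..n}"] by (auto simp: k_subsets_def)
    then have "sorted_list_of_set I ! m \<in> {1..n}" if "m < 2" for m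
      using that assms(1) nth_mem[of m "sorted_list_of_set I"] by auto
    then show ?thesis using assms(2) by (simp add: order_field_def Let_def)
  qed
  then show ?thesis unfolding mf_polytope_def mf_vertex_def by (simp cong: image_cong)
qed

section \<open>Exchanging vertices and transposing adjacent columns\<close>

text \<open>If both ways of exchanging failed, one pair would lie entirely below the other.\<close>

lemma exchange_tails:
  fixes R R' :: "nat set"
  assumes "\<forall>r\<in>R. x1 < r \<and> x2 < r" "\<forall>r\<in>R'. y1 < r \<and> y2 < r"
    and "\<not> (x1 < y1 \<and> x1 < y2 \<and> x2 < y1 \<and> x2 < y2)"
    and "\<not> (y1 < x1 \<and> y1 < x2 \<and> y2 < x1 \<and> y2 < x2)"
  obtains R1 R2 where "R1 = R \<and> R2 = R' \<or> R1 = R' \<and> R2 = R"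
    "\<forall>r\<in>R1. x1 < r \<and> y2 < r" "\<forall>r\<in>R2. y1 < r \<and> x2 < r"
proof -
  have "((\<forall>r\<in>R'. x1 < r) \<and> (\<forall>r\<in>R. y1 < r)) \<or> ((\<forall>r\<in>R. y2 < r) \<and> (\<forall>r\<in>R'. x2 < r))"
  proof (rule ccontr)
    assume "\<not> ?thesis"
    \<comment> \<open>Each alternative fails because of one element of each of two tails. Two
      witnesses from the same tail put one pair entirely below the other; witnesses from different
      tails give a cycle such as \<open>y2 < r \<le> x1 < s \<le> y2\<close>.\<close>
    then consider r s where "r \<in> R'" "s \<in> R'" "r \<le> x1" "s \<le> x2"
      | r s where "r \<in> R'" "s \<in> R" "r \<le> x1" "s \<le> y2"
      | r s where "r \<in> R" "s \<in> R" "r \<le> y1" "s \<le> y2"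
      | r s where "r \<in> R" "s \<in> R'" "r \<le> y1" "s \<le> x2"
      by (metis not_less)
    then show False
    proof cases
      case 1
      then show False using assms(2)[rule_format, of r] assms(2)[rule_format, of s] assms(4) by linarith
    next
      case 2
      then show False using assms(2)[rule_format, of r] assms(1)[rule_format, of s] by linarith
    next
      case 3
      then show False using assms(1)[rule_format, of r] assms(1)[rule_format, of s] assms(3) by linarith
    next
      case 4
      then show False using assms(1)[rule_format, of r] assms(2)[rule_format, of s] by linarith
    qed
  qed
  then show ?thesis using that[of R' R] that[of R R'] assms(1,2) by blast
qed

text \<open>The sum of two vertices is determined row by row, so the entries of row 2 and the tails
  can be redistributed independently.\<close>

lemma tri_vertex_exchange:
  assumes "R1 = R \<and> R2 = R' \<or> R1 = R' \<and> R2 = R"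
  shows "tri_vertex k x1 x2 R i + tri_vertex k y1 y2 R' i =
    tri_vertex k x1 y2 R1 i + tri_vertex k y1 x2 R2 i"
  using assms by (cases i) (auto simp: tri_vertex_def)

text \<open>The assumptions \<open>adj\<close> and \<open>same\<close> say that \<open>p\<close>,
  \<open>j\<close> are consecutive under \<open>\<kappa>\<close> and that \<open>\<kappa>'\<close>
  reverses this pair only. The assumption \<open>sep\<close> provides the separation hypotheses of
  \<open>exchange_tails\<close> for \<open>(p, j)\<close> or \<open>(j, p)\<close> against any pair
  \<open>(a, b)\<close> with \<open>f = 1\<close>.\<close>

lemma mutation_step_swap:
  assumes kn: "2 \<le> k" "k \<le> n" and inj: "inj_on \<kappa> {1..n}" "inj_on \<kappa>' {1..n}"
    and pj: "p \<in> {1..n}" "j \<in> {1..n}" "\<kappa> p < \<kappa> j" "\<kappa>' j < \<kappa>' p"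
    and adj: "\<And>x. x \<in> {1..n} \<Longrightarrow> \<not> (\<kappa> p < \<kappa> x \<and> \<kappa> x < \<kappa> j)"
    and same: "\<And>x y. x \<in> {1..n} \<Longrightarrow> y \<in> {1..n} \<Longrightarrow> (x, y) \<noteq> (p, j) \<Longrightarrow> (x, y) \<noteq> (j, p) \<Longrightarrow>
      \<kappa> x < \<kappa> y \<longleftrightarrow> \<kappa>' x < \<kappa>' y"
    and sep: "\<And>a b. a \<in> {1..n} \<Longrightarrow> b \<in> {1..n} \<Longrightarrow> \<kappa> a < \<kappa> p \<Longrightarrow> \<kappa> j < \<kappa> b \<Longrightarrow>
      \<not> (p < a \<and> p < b \<and> j < a \<and> j < b) \<and> \<not> (a < p \<and> a < j \<and> b < p \<and> b < j)"
  shows "mutation_step (mf_polytope k n (order_field \<kappa>)) (mf_polytope k n (order_field \<kappa>'))"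
proof -
  let ?v = "\<lambda>(x, y, R). tri_vertex k x y R"
  define V where "V = ?v ` triples k n \<kappa>"
  define V' where "V' = ?v ` triples k n \<kappa>'"
  have V_image: "V = mf_vertex k (order_field \<kappa>) ` k_subsets k n"
    unfolding V_def by (rule mf_vertex_image_order_field[OF kn(1) inj(1), symmetric])
  have V'_image: "V' = mf_vertex k (order_field \<kappa>') ` k_subsets k n"
    unfolding V'_def by (rule mf_vertex_image_order_field[OF kn(1) inj(2), symmetric])
  define A where "A = {a\<in>{1..n}. \<kappa> a < \<kappa> p}"
  define B where "B = {b\<in>{1..n}. \<kappa> b \<le> \<kappa> j}"
  have finAB: "finite A" "finite B" by (simp_all add: A_def B_def)
  define f :: "(nat \<times> nat \<Rightarrow> real) \<Rightarrow> real" where "f = (\<lambda>u. (\<Sum>a\<in>A. u (1, a)) - (\<Sum>b\<in>B. u (2, b)))"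
  define w :: "nat \<times> nat \<Rightarrow> real" where
    "w = (\<lambda>(a, b). if a = 1 then of_bool (b = j) - of_bool (b = p)
       else if a = 2 then of_bool (b = p) - of_bool (b = j) else 0)"
  have pj': "p \<noteq> j" "p \<notin> A" "j \<notin> A" "p \<in> B" "j \<in> B" using pj by (auto simp: A_def B_def)
  have f_tri: "f (tri_vertex k x y R) = of_bool (x \<in> A) - of_bool (y \<in> B)" for x y R
    using finAB by (simp add: f_def tri_vertex_def of_bool_def)
  \<comment> \<open>A negative value means that \<open>x\<close> is not before \<open>p\<close> and
    \<open>y\<close> is not after \<open>j\<close>; as \<open>x\<close> precedes \<open>y\<close>
    and nothing lies strictly between \<open>p\<close> and \<open>j\<close>, this leaves only
    \<open>(p, j)\<close>.\<close>
  have neg: "x = p \<and> y = j" if "(x, y, R) \<in> triples k n \<kappa>" "f (tri_vertex k x y R) < 0" for x y R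
  proof -
    have *: "x \<in> {1..n}" "y \<in> {1..n}" "\<kappa> x < \<kappa> y" using that(1) by (auto simp: triples_def)
    have **: "\<kappa> p \<le> \<kappa> x" "\<kappa> y \<le> \<kappa> j"
      using that(2) * unfolding f_tri by (auto simp: A_def B_def of_bool_def split: if_splits)
    have "\<kappa> x = \<kappa> p" using adj[OF *(1)] * ** by linarith
    moreover have "\<kappa> y = \<kappa> j" using adj[OF *(2)] * ** by linarith
    ultimately show ?thesis using inj(1) * pj by (auto dest: inj_onD)
  qed
  have pos: "x \<in> A \<and> y \<notin> B" if "0 < f (tri_vertex k x y R)" for x y R
    using that unfolding f_tri by (auto simp: of_bool_def split: if_splits)
  have moved: "tri_vertex k p j R i - (- 1) * w i = tri_vertex k j p R i" for R i
    using pj' by (cases i) (auto simp: tri_vertex_def w_def)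
  have rel: "(x, y, R) \<in> triples k n \<kappa> \<longleftrightarrow> (x, y, R) \<in> triples k n \<kappa>'"
    if "(x, y) \<noteq> (p, j)" "(x, y) \<noteq> (j, p)" for x y R
    using same[of x y] that by (auto simp: triples_def)
  interpret exchange_mutation V "{1..k} \<times> {1..n}" f w "(1, j)"
  proof
    show "finite V" unfolding V_image by (simp add: k_subsets_def)
    have "{1..k} \<in> k_subsets k n" using kn by (simp add: k_subsets_def)
    then show "V \<noteq> {}" unfolding V_image by blast
    show "finite ({1..k} \<times> {1..n})" by simp
    show "integer_point v" if "v \<in> V" for v
      using that by (auto simp: V_def integer_point_def tri_vertex_def)
    show "v i = 0" if v: "v \<in> V" and i: "i \<notin> {1..k} \<times> {1..n}" for v i
    proof -
      obtain x y R where t: "(x, y, R) \<in> triples k n \<kappa>" "v = tri_vertex k x y R"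
        using v by (auto simp: V_def)
      obtain a b where ab: "i = (a, b)" by (cases i)
      have "sorted_list_of_set R ! (a - 3) \<in> {1..n}" if "3 \<le> a" "a \<le> k"
      proof -
        have "a - 3 < length (sorted_list_of_set R)" using t(1) that by (auto simp: triples_def)
        from nth_mem[OF this] show ?thesis
          using t(1) finite_subset[of R "{1..n}"] by (auto simp: triples_def)
      qed
      then show ?thesis using t i kn unfolding ab by (auto simp: tri_vertex_def triples_def)
    qed
    show "linear_form f"
      by (simp add: linear_form_def f_def sum.distrib right_diff_distrib sum_distrib_left)
    show "f x \<in> \<int>" if "integer_point x" for x
      using that by (auto simp: f_def integer_point_def intro!: Ints_diff Ints_sum)
    show "f w = 0" using finAB pj' by (simp add: f_def w_def sum_subtractf of_bool_def)
    show "integer_point w" by (auto simp: integer_point_def w_def)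
    show "w (1, j) = 1" using pj' by (simp add: w_def)
    fix u v assume uv: "u \<in> V" "v \<in> V" "f u < 0" "0 < f v"
    obtain x y R where u': "(x, y, R) \<in> triples k n \<kappa>" "u = tri_vertex k x y R"
      using uv(1) by (auto simp: V_def)
    have "x = p \<and> y = j" using neg u' uv(3) by blast
    with u' have u: "(p, j, R) \<in> triples k n \<kappa>" "u = tri_vertex k p j R" by simp_all
    obtain a b R' where v: "(a, b, R') \<in> triples k n \<kappa>" "v = tri_vertex k a b R'"
      using uv(2) by (auto simp: V_def)
    have ab: "a \<in> A" "b \<notin> B" using pos[of a b R'] v(2) uv(4) by simp_all
    have R: "\<forall>r\<in>R. p < r \<and> j < r" "\<forall>r\<in>R. j < r \<and> p < r" "R \<subseteq> {1..n}" "card R + 2 = k"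
      and R': "\<forall>r\<in>R'. a < r \<and> b < r" "R' \<subseteq> {1..n}" "card R' + 2 = k"
      and abn: "a \<in> {1..n}" "b \<in> {1..n}"
      using u(1) v(1) by (auto simp: triples_def)
    have ord: "\<kappa> a < \<kappa> p" "\<kappa> j < \<kappa> b" using ab abn by (auto simp: A_def B_def)
    note s = sep[OF abn ord]
    have mem: "tri_vertex k x y R'' \<in> V"
      if "R'' = R \<or> R'' = R'" "\<forall>r\<in>R''. x < r \<and> y < r" "x \<in> {1..n}" "y \<in> {1..n}" "\<kappa> x < \<kappa> y" for x y R''
    proof -
      have "(x, y, R'') \<in> triples k n \<kappa>" using that R R' by (auto simp: triples_def)
      then show ?thesis unfolding V_def by (intro image_eqI) auto
    qed
    \<comment> \<open>Before the mutation \<open>(p, j)\<close> and \<open>(a, b)\<close> are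
      exchanged for \<open>(p, b)\<close> and \<open>(a, j)\<close>. In the first new pair neither
      entry counts for \<open>f\<close>; in the second both do and cancel.\<close>
    obtain R1 R2 where 1: "R1 = R \<and> R2 = R' \<or> R1 = R' \<and> R2 = R"
      "\<forall>r\<in>R1. p < r \<and> b < r" "\<forall>r\<in>R2. a < r \<and> j < r"
      by (rule exchange_tails[OF R(1) R'(1)]) (use s in auto)
    have "tri_vertex k p b R1 \<in> V" "tri_vertex k a j R2 \<in> V"
      using 1 abn pj ord by (auto intro!: mem)
    moreover have "f (tri_vertex k p b R1) = 0" "f (tri_vertex k a j R2) = 0"
      using ab pj' by (simp_all add: f_tri)
    moreover have "u i + v i = tri_vertex k p b R1 i + tri_vertex k a j R2 i" for i
      unfolding u(2) v(2) by (rule tri_vertex_exchange[OF 1(1)])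
    ultimately show "\<exists>x\<in>V. \<exists>y\<in>V. f x = 0 \<and> f y = 0 \<and> (\<forall>i. u i + v i = x i + y i)" by blast
    \<comment> \<open>After the mutation \<open>(p, j)\<close> has become \<open>(j, p)\<close>,
      which with \<open>(a, b)\<close> is exchanged for \<open>(j, b)\<close> and
      \<open>(a, p)\<close>.\<close>
    obtain S1 S2 where 2: "S1 = R \<and> S2 = R' \<or> S1 = R' \<and> S2 = R"
      "\<forall>r\<in>S1. j < r \<and> b < r" "\<forall>r\<in>S2. a < r \<and> p < r"
      by (rule exchange_tails[OF R(2) R'(1)]) (use s in auto)
    have "tri_vertex k j b S1 \<in> V" "tri_vertex k a p S2 \<in> V"
      using 2 abn pj ord by (auto intro!: mem)
    moreover have "f (tri_vertex k j b S1) = 0" "f (tri_vertex k a p S2) = 0"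
      using ab pj' by (simp_all add: f_tri)
    moreover have "u i - f u * w i + v i = tri_vertex k j b S1 i + tri_vertex k a p S2 i" for i
    proof -
      have "f u = - 1" using pj' by (simp add: u(2) f_tri)
      then have "u i - f u * w i = tri_vertex k j p R i" using moved[of R i] u(2) by simp
      then show ?thesis using tri_vertex_exchange[OF 2(1)] v(2) by simp
    qed
    ultimately show "\<exists>x\<in>V. \<exists>y\<in>V. f x = 0 \<and> f y = 0 \<and> (\<forall>i. u i - f u * w i + v i = x i + y i)"
      by blast
  qed
  have \<phi>_pj: "\<phi> (tri_vertex k p j R) = tri_vertex k j p R" for R
  proof -
    have "f (tri_vertex k p j R) = - 1" using pj' by (simp add: f_tri)
    then show ?thesis using moved[of R] by (simp add: \<phi>_def fun_eq_iff)
  qed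
  have \<phi>_other: "\<phi> (tri_vertex k x y R) = tri_vertex k x y R"
    if "(x, y, R) \<in> triples k n \<kappa>" "(x, y) \<noteq> (p, j)" for x y R
    using neg[OF that(1)] that(2) by (intro \<phi>_nonneg) force
  have "\<phi> ` V = V'"
  proof (intro equalityI subsetI)
    fix v assume "v \<in> \<phi> ` V"
    then obtain x y R where t: "(x, y, R) \<in> triples k n \<kappa>" "v = \<phi> (tri_vertex k x y R)"
      by (auto simp: V_def)
    show "v \<in> V'"
    proof (cases "(x, y) = (p, j)")
      case True
      then have "(j, p, R) \<in> triples k n \<kappa>'" "v = tri_vertex k j p R"
        using t pj by (auto simp: triples_def \<phi>_pj)
      then show ?thesis unfolding V'_def by (intro image_eqI) auto
    next
      case False
      moreover have "(x, y) \<noteq> (j, p)" using t(1) pj(3) by (auto simp: triples_def)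
      ultimately have "(x, y, R) \<in> triples k n \<kappa>'" "v = tri_vertex k x y R"
        using t rel \<phi>_other by auto
      then show ?thesis unfolding V'_def by (intro image_eqI) auto
    qed
  next
    fix v assume "v \<in> V'"
    then obtain x y R where t: "(x, y, R) \<in> triples k n \<kappa>'" "v = tri_vertex k x y R"
      by (auto simp: V'_def)
    have "\<exists>x' y'. (x', y', R) \<in> triples k n \<kappa> \<and> v = \<phi> (tri_vertex k x' y' R)"
    proof (cases "(x, y) = (j, p)")
      case True
      then have "(p, j, R) \<in> triples k n \<kappa>" using t pj by (auto simp: triples_def)
      then show ?thesis using t(2) True \<phi>_pj by (intro exI[of _ p] exI[of _ j]) simp
    next
      case False
      moreover have "(x, y) \<noteq> (p, j)" using t(1) pj(4) by (auto simp: triples_def)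
      ultimately have "(x, y, R) \<in> triples k n \<kappa>" "v = \<phi> (tri_vertex k x y R)"
        using t rel \<phi>_other by auto
      then show ?thesis by blast
    qed
    then obtain x' y' where t': "(x', y', R) \<in> triples k n \<kappa>" "v = \<phi> (tri_vertex k x' y' R)" by blast
    then have "tri_vertex k x' y' R \<in> V" unfolding V_def by (intro image_eqI) auto
    then show "v \<in> \<phi> ` V" using t'(2) by blast
  qed
  moreover have "mutation_step (conv_hull V) (conv_hull (\<phi> ` V))"
  proof (rule mutation_step_conv_hull)
    fix v assume "v \<in> V"
    then obtain x y R where "v = tri_vertex k x y R" by (auto simp: V_def)
    then show "f v \<in> {-1, 0, 1}" by (cases "x \<in> A"; cases "y \<in> B") (simp_all add: f_tri)
  qed
  ultimately show ?thesis by (simp add: mf_polytope_def V_image V'_image)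
qed

section \<open>Moving one column through the order\<close>

definition shifted :: "nat \<Rightarrow> nat \<Rightarrow> nat \<Rightarrow> nat" where
  "shifted n l x = (if x \<le> l then x + n else x)"

text \<open>Column \<open>Suc l\<close> is inserted right after the columns of shifted value at most \<open>t\<close>; it comes
  first for \<open>t = Suc l\<close> and last for \<open>t = n + l\<close>.\<close>

definition inserted :: "nat \<Rightarrow> nat \<Rightarrow> nat \<Rightarrow> nat \<Rightarrow> nat" where
  "inserted n l t x = (if x = Suc l then 2 * t + 1 else 2 * shifted n l x)"

text \<open>For the two smallest elements \<open>i < j\<close> of \<open>I\<close>, the intersection
  with \<open>{1..l}\<close> has one element exactly if \<open>i \<le> l < j\<close>. This is also
  the only case in which the shift reverses the two, because
  \<open>j \<le> n < i + n\<close>.\<close>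

lemma mf_polytope_block_diag:
  assumes "2 \<le> k" "l \<le> n"
  shows "mf_polytope k n (block_diag l) = mf_polytope k n (order_field (shifted n l))"
proof -
  have "block_diag l I = order_field (shifted n l) I" if I_mem: "I \<in> k_subsets k n" for I
  proof -
    obtain i j R where I: "I = insert i (insert j R)" "i < j" "j \<le> n" "1 \<le> i" "R \<subseteq> {1..n}"
      "card R + 2 = k" "\<forall>r\<in>R. j < r" by (rule k_subset_cases[OF I_mem assms(1)])
    have "finite R" using I(5) finite_subset by blast
    then have L: "sorted_list_of_set I = i # j # sorted_list_of_set R"
      unfolding I(1) by (rule sorted_list_of_set_insert_two[OF I(2) _ I(7)])
    have "card (I \<inter> {1..l}) \<noteq> 1 \<longleftrightarrow> shifted n l i < shifted n l j"
    proof -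
      consider "j \<le> l" | "i \<le> l" "l < j" | "l < i" using I(2) by linarith
      then show ?thesis
      proof cases
        case 1
        then have "{i, j} \<subseteq> I \<inter> {1..l}" using I by auto
        then have "card {i, j} \<le> card (I \<inter> {1..l})" by (intro card_mono) auto
        then show ?thesis using 1 I(2) by (simp add: shifted_def)
      next
        case 2
        then have "I \<inter> {1..l} = {i}" using I by fastforce
        then show ?thesis using 2 I(3) by (simp add: shifted_def)
      next
        case 3
        then have "I \<inter> {1..l} = {}" using I by fastforce
        then show ?thesis using 3 I(2) by (simp add: shifted_def)
      qed
    qed
    then show ?thesis by (simp add: block_diag_def order_field_def L)
  qed
  then show ?thesis unfolding mf_polytope_def mf_vertex_def by (simp cong: image_cong)
qed

lemma mutation_step_inserted:
  assumes "2 \<le> k" "k \<le> n" "l < n" "Suc l \<le> t" "Suc t \<le> n + l"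
  shows "mutation_step (mf_polytope k n (order_field (inserted n l t)))
    (mf_polytope k n (order_field (inserted n l (Suc t))))"
proof -
  \<comment> \<open>The column with shifted value \<open>Suc t\<close>, which is the next one that
    column \<open>Suc l\<close> passes.\<close>
  define j where "j = (if Suc t \<le> n then Suc t else Suc t - n)"
  have j: "j \<in> {1..n}" "j \<noteq> Suc l" and jt: "shifted n l j = Suc t"
    using assms by (auto simp: j_def shifted_def)
  have sh: "shifted n l x = shifted n l y \<longleftrightarrow> x = y" if "x \<in> {1..n}" "y \<in> {1..n}" for x y
    using that by (auto simp: shifted_def)
  have jj: "inserted n l s j = 2 * Suc t" for s using j jt by (simp add: inserted_def)
  have inj: "inj_on (inserted n l s) {1..n}" for s
  proof (rule inj_onI)
    fix x y assume xy: "x \<in> {1..n}" "y \<in> {1..n}" "inserted n l s x = inserted n l s y"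
    \<comment> \<open>The inserted column has an odd value, all others have even ones. In particular
      nothing fits between \<open>2 * t + 1\<close> and the value \<open>2 * Suc t\<close> of
      \<open>j\<close>.\<close>
    have "2 * s + 1 \<noteq> 2 * m" for m by presburger
    from this[of "shifted n l x"] this[of "shifted n l y"] show "x = y"
      using xy(3) sh[OF xy(1,2)] by (simp add: inserted_def split: if_splits)
  qed
  show ?thesis
  proof (rule mutation_step_swap[where p = "Suc l" and j = j])
    show "inj_on (inserted n l t) {1..n}" "inj_on (inserted n l (Suc t)) {1..n}" by (rule inj)+
    show "Suc l \<in> {1..n}" "j \<in> {1..n}" using assms j by auto
    show "inserted n l t (Suc l) < inserted n l t j" "inserted n l (Suc t) j < inserted n l (Suc t) (Suc l)"
      by (simp_all add: jj) (simp_all add: inserted_def)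
    show "\<not> (inserted n l t (Suc l) < inserted n l t x \<and> inserted n l t x < inserted n l t j)" for x
      unfolding jj by (auto simp: inserted_def)
    fix x y assume xy: "x \<in> {1..n}" "y \<in> {1..n}"
    show "inserted n l t x < inserted n l t y \<longleftrightarrow> inserted n l (Suc t) x < inserted n l (Suc t) y"
      if "(x, y) \<noteq> (Suc l, j)" "(x, y) \<noteq> (j, Suc l)"
    proof -
      have "x = Suc l \<Longrightarrow> shifted n l y \<noteq> Suc t" "y = Suc l \<Longrightarrow> shifted n l x \<noteq> Suc t"
        using that sh[OF _ j(1)] xy jt by metis+
      then show ?thesis by (auto simp: inserted_def)
    qed
    \<comment> \<open>If \<open>Suc t \<le> n\<close>, then \<open>Suc l < x < j\<close>; otherwise
      \<open>j < y < Suc l\<close>. Either way one column of the pair lies strictly between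
      \<open>Suc l\<close> and \<open>j\<close>, so the pair is neither entirely above nor entirely
      below them.\<close>
    show "\<not> (Suc l < x \<and> Suc l < y \<and> j < x \<and> j < y) \<and> \<not> (x < Suc l \<and> x < j \<and> y < Suc l \<and> y < j)"
      if "inserted n l t x < inserted n l t (Suc l)" "inserted n l t j < inserted n l t y"
    proof -
      have "x \<noteq> Suc l" "shifted n l x \<le> t" using that(1) by (auto simp: inserted_def split: if_splits)
      moreover have "y \<noteq> Suc l" "Suc t < shifted n l y"
        using that(2) unfolding jj by (auto simp: inserted_def split: if_splits)
      ultimately show ?thesis using xy assms by (auto simp: shifted_def j_def split: if_splits)
    qed
  qed (use assms in auto)
qed

section \<open>Chaining the steps around the cycle of block diagonal fields\<close>

theorem theorem1p2:
  fixes k n l l' :: nat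
  assumes "2 \<le> k" and "k \<le> n" and "l \<le> n" and "l' \<le> n"
  shows "\<exists>Qs. Qs \<noteq> [] \<and> hd Qs = mf_polytope k n (block_diag l)
           \<and> last Qs = mf_polytope k n (block_diag l')
           \<and> (\<forall>Q\<in>set Qs. \<exists>\<Lambda>. matching_field k n \<Lambda> \<and> Q = mf_polytope k n \<Lambda>)
           \<and> (\<forall>i. Suc i < length Qs \<longrightarrow> mutation_step (Qs ! i) (Qs ! Suc i))"
proof -
  let ?M = "\<lambda>Q. \<exists>\<Lambda>. matching_field k n \<Lambda> \<and> Q = mf_polytope k n \<Lambda>"
  let ?P = "\<lambda>\<kappa>. mf_polytope k n (order_field \<kappa>)"
  define R where "R = (\<lambda>P Q. ?M P \<and> ?M Q \<and> mutation_step P Q)"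
  have M: "?M (?P \<kappa>)" for \<kappa> using matching_field_order_field[OF assms(1)] by blast
  \<comment> \<open>All other columns have shifted values from \<open>l + 2\<close> to
    \<open>n + l\<close>, so inserting at \<open>Suc l\<close> puts column \<open>Suc l\<close>
    first and inserting at \<open>n + l\<close> puts it last.\<close>
  have first: "?P (inserted n l (Suc l)) = ?P (shifted n l)" if "l < n" for l
    using that by (intro order_field_cong assms(1)) (auto simp: inserted_def shifted_def)
  have last: "?P (inserted n l (n + l)) = ?P (shifted n (Suc l))" if "l < n" for l
    using that by (intro order_field_cong assms(1)) (auto simp: inserted_def shifted_def)
  have pass: "R\<^sup>*\<^sup>* (?P (inserted n l (Suc l))) (?P (inserted n l t))"
    if "Suc l \<le> t" "t \<le> n + l" "l < n" for l t
    using that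
  proof (induction t rule: dec_induct)
    case (step t)
    then have "R (?P (inserted n l t)) (?P (inserted n l (Suc t)))"
      unfolding R_def using M mutation_step_inserted[OF assms(1,2)] by simp
    with step show ?case by (simp add: rtranclp.rtrancl_into_rtrancl)
  qed simp
  have next_block: "R\<^sup>*\<^sup>* (?P (shifted n l)) (?P (shifted n (Suc l)))" if "l < n" for l
    using pass[of l "n + l"] that first[OF that] last[OF that] by simp
  have up: "R\<^sup>*\<^sup>* (?P (shifted n l)) (?P (shifted n m))" if "l \<le> m" "m \<le> n" for l m
    using that
  proof (induction m rule: dec_induct)
    case (step m)
    then show ?case using rtranclp_trans[OF _ next_block[of m]] by simp
  qed simp
  \<comment> \<open>Shifting every column by \<open>n\<close> preserves the order. The steps only
    raise \<open>l\<close>, so a smaller \<open>l'\<close> is reached by going up to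
    \<open>n\<close>, which is the same polytope as 0, and up again.\<close>
  have "?P (shifted n n) = ?P (shifted n 0)"
    by (intro order_field_cong assms(1)) (auto simp: shifted_def)
  then have "R\<^sup>*\<^sup>* (?P (shifted n l)) (?P (shifted n l'))"
    using rtranclp_trans[OF up[OF assms(3) order_refl]] up[of 0 l'] assms(4) by simp
  moreover have "\<exists>Qs. Qs \<noteq> [] \<and> hd Qs = P \<and> last Qs = Q \<and> (\<forall>Q\<in>set Qs. ?M Q)
      \<and> (\<forall>i. Suc i < length Qs \<longrightarrow> mutation_step (Qs ! i) (Qs ! Suc i))"
    if "R\<^sup>*\<^sup>* P Q" "?M P" for P Q
    using that(1)
  proof (induction rule: rtranclp_induct)
    case base
    show ?case using that(2) by (intro exI[of _ "[P]"]) simp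
  next
    case (step Q Q')
    then obtain Qs where Qs: "Qs \<noteq> []" "hd Qs = P" "last Qs = Q" "\<forall>Q\<in>set Qs. ?M Q"
      "\<forall>i. Suc i < length Qs \<longrightarrow> mutation_step (Qs ! i) (Qs ! Suc i)" by (elim exE conjE)
    have Q': "?M Q'" "mutation_step Q Q'" using step.hyps(2) by (simp_all add: R_def)
    have "mutation_step ((Qs @ [Q']) ! i) ((Qs @ [Q']) ! Suc i)" if i: "Suc i < length (Qs @ [Q'])" for i
    proof (cases "Suc i < length Qs")
      case True
      then show ?thesis using Qs(5) by (simp add: nth_append)
    next
      case False
      then have "Suc i = length Qs" using i by simp
      moreover from this have "Qs ! i = Q" using Qs(1,3) by (simp add: last_conv_nth flip: \<open>Suc i = length Qs\<close>)
      ultimately show ?thesis using Q'(2) by (simp add: nth_append)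
    qed
    then show ?case using Qs Q'(1) by (intro exI[of _ "Qs @ [Q']"]) auto
  qed
  ultimately have "\<exists>Qs. Qs \<noteq> [] \<and> hd Qs = ?P (shifted n l) \<and> last Qs = ?P (shifted n l')
      \<and> (\<forall>Q\<in>set Qs. ?M Q) \<and> (\<forall>i. Suc i < length Qs \<longrightarrow> mutation_step (Qs ! i) (Qs ! Suc i))"
    using M[of "shifted n l"] by simp
  then show ?thesis by (simp only: mf_polytope_block_diag assms)
qed

end
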